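(* Let $n\ge1$, $Q:[0,\infty)\to\mathbb{C}^{n\times n}$ with $Q=Q^*$ and $\int_0^\infty(1+t)|Q(t)|\,dt<\infty$, $U$ an $n\times n$ unitary matrix, and $\mathcal{L}=-\frac{d^2}{dx^2}+Q$ the selfadjoint operator on $L^2([0,\infty);\mathbb{C}^n)$ with boundary condition $\frac{i}{2}(U^*-\mathbb{I})f(0)+\frac12(U^*+\mathbb{I})f'(0)=0$, assumed to have no virtual level at zero. Put $A=\frac12(U+\mathbb{I})$, $B=\frac{i}{2}(U-\mathbb{I})$ and for $\operatorname{Im}k>0$ $$M_-(k)=-\frac{1}{2ik}\Big[F(0,-\bar k)^*B-F_x(0,-\bar k)^*A\Big].$$ Then all poles of $M_-(k)^{-1}$ in the half-plane $\operatorname{Im}k>0$ are simple: at each such pole $k_l$, $M_-(k)^{-1}$ has a Laurent expansion in $k-k_l$ whose lowest-order term is $(k-k_l)^{-1}N_l$ for some matrix $N_l$.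
   Context: The Jost solution $F(x,k)$ ($\operatorname{Im}k\ge0$) is the matrix solution of $-F''+QF=k^2F$ with $F(x,k)-e^{ikx}\mathbb{I}\to0$ as $x\to\infty$; it is analytic in $k$ for $\operatorname{Im}k>0$, and $F_x$ is its $x$-derivative. "No virtual level at zero" is the paper's standing assumption that zero is not a virtual level (in particular not an eigenvalue) of $\mathcal{L}$.
   Formalization: The Jost solution is normalized by e^{-ikx}F(x,k) → I as x → ∞, because F(x,k) − e^{ikx}I → 0 alone does not determine F when Im k > 0 (every decaying solution satisfies it). *)

theory Defs
  imports "HOL-Analysis.Analysis"
begin

definition adj_mat :: "complex^'n^'n \<Rightarrow> complex^'n^'n" where
  "adj_mat A = (\<chi> i j. cnj (A $ j $ i))"

definition smat :: "complex \<Rightarrow> complex^'n^'n \<Rightarrow> complex^'n^'n" where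
  "smat c A = (\<chi> i j. c * A $ i $ j)"

definition unitary_mat :: "complex^'n^'n \<Rightarrow> bool" where
  "unitary_mat U \<longleftrightarrow> adj_mat U ** U = mat 1 \<and> U ** adj_mat U = mat 1"

text \<open>Matrix Jost solution: for every k with Im k \<ge> 0, x \<mapsto> F x k solves
  -F'' + Q F = k^2 F on [0,\<infinity>) (F' = Fx, Fx absolutely continuous with
  Fx' = (Q - k^2) F a.e., written in integrated form), normalised by
  e^{-ikx} F(x,k) \<rightarrow> I as x \<rightarrow> \<infinity>.\<close>
definition jost_solution ::
  "(real \<Rightarrow> complex^'n^'n) \<Rightarrow> (real \<Rightarrow> complex \<Rightarrow> complex^'n^'n)
     \<Rightarrow> (real \<Rightarrow> complex \<Rightarrow> complex^'n^'n) \<Rightarrow> bool" where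
  "jost_solution Q F Fx \<longleftrightarrow>
     (\<forall>k. Im k \<ge> 0 \<longrightarrow>
        (\<forall>x\<ge>0. ((\<lambda>y. F y k) has_vector_derivative Fx x k) (at x within {0..})) \<and>
        (\<forall>x\<ge>0. ((\<lambda>t. Q t ** F t k - smat (k^2) (F t k)) has_integral (Fx x k - Fx 0 k)) {0..x}) \<and>
        ((\<lambda>x. smat (exp (- \<i> * k * of_real x)) (F x k)) \<longlongrightarrow> mat 1) at_top)"

text \<open>Zero is a virtual level of L (potential Q, boundary matrix U): there is a
  nontrivial bounded solution of -f'' + Q f = 0 on [0,\<infinity>) satisfying the
  boundary condition (i/2)(U^* - I) f(0) + (1/2)(U^* + I) f'(0) = 0.
  (This includes the case that 0 is an eigenvalue.)\<close>
definition virtual_level_at_zero ::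
  "(real \<Rightarrow> complex^'n^'n) \<Rightarrow> complex^'n^'n \<Rightarrow> bool" where
  "virtual_level_at_zero Q U \<longleftrightarrow>
     (\<exists>f f' :: real \<Rightarrow> complex^'n.
        (\<forall>x\<ge>0. (f has_vector_derivative f' x) (at x within {0..})) \<and>
        (\<forall>x\<ge>0. ((\<lambda>t. Q t *v f t) has_integral (f' x - f' 0)) {0..x}) \<and>
        bounded (f ` {0..}) \<and>
        smat (\<i>/2) (adj_mat U - mat 1) *v f 0 + smat (1/2) (adj_mat U + mat 1) *v f' 0 = 0 \<and>
        (\<exists>x\<ge>0. f x \<noteq> 0))"

definition A_mat :: "complex^'n^'n \<Rightarrow> complex^'n^'n" where
  "A_mat U = smat (1/2) (U + mat 1)"

definition B_mat :: "complex^'n^'n \<Rightarrow> complex^'n^'n" where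
  "B_mat U = smat (\<i>/2) (U - mat 1)"

definition M_minus ::
  "(real \<Rightarrow> complex \<Rightarrow> complex^'n^'n) \<Rightarrow> (real \<Rightarrow> complex \<Rightarrow> complex^'n^'n)
     \<Rightarrow> complex^'n^'n \<Rightarrow> complex \<Rightarrow> complex^'n^'n" where
  "M_minus F Fx U k = smat (- 1 / (2 * \<i> * k))
      (adj_mat (F 0 (- cnj k)) ** B_mat U - adj_mat (Fx 0 (- cnj k)) ** A_mat U)"

end

theory Submission
  imports Defs "HOL-Complex_Analysis.Complex_Analysis"
begin

text \<open>
  Put \<open>\<zeta> = - cnj k\<close> and \<open>f(x) = F(x,\<zeta>) v\<close>. Up to the factor \<open>1/(2 cnj k)\<close> and a unimodular
  constant, \<open>M\<^sub>-(k)\<^sup>* v\<close> is the boundary vector \<open>w = (\<i>/2)(U\<^sup>* - I) f(0) + (1/2)(U\<^sup>* + I) f'(0)\<close>.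
  Green's identity gives \<open>|Im \<zeta>\<^sup>2| \<integral>|f|\<^sup>2 = |Im \<langle>f(0), f'(0)\<rangle>|\<close>, and unitarity of \<open>U\<close> bounds the right-hand
  side by \<open>|w| (|f(0)| + |f'(0)|)\<close>. Hence \<open>|M\<^sub>-(k)\<^sup>* v| \<ge> c |Re k| |v|\<close> locally uniformly in \<open>k\<close>, so
  \<open>M\<^sub>-(k)\<close> is invertible off the imaginary axis and \<open>(k - k\<^sub>0) M\<^sub>-(k)\<^sup>-\<^sup>1\<close> stays bounded as \<open>k\<close>
  approaches \<open>k\<^sub>0\<close> horizontally. As \<open>M\<^sub>-\<close> is holomorphic, \<open>M\<^sub>-\<^sup>-\<^sup>1\<close> is meromorphic by Cramer's
  rule, and boundedness along one sequence already rules out a pole of order two or more.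

  Holomorphy of \<open>F(0,k)\<close> and \<open>F\<^sub>x(0,k)\<close> comes from the Volterra equation
  \<open>m(x) = v + \<integral>\<^sub>x\<^sup>\<infinity> (exp(2\<i>k(t-x)) - 1)/(2\<i>k) Q(t) m(t) dt\<close> for \<open>m(x) = exp(-\<i>kx) F(x,k) v\<close>, whose
  Neumann series converges locally uniformly in \<open>k\<close>.
\<close>

text \<open>Two obstacles shape the development. The potential \<open>Q\<close> is merely
  integrable, so \<open>f'\<close> is only an indefinite integral and need not be differentiable at
  every point; the integrations by parts behind the Volterra equation, the factorials of the Neumann
  series and Green's identity all go through one product rule for indefinite integrals. Moreover
  \<open>jost_solution\<close> prescribes \<open>F\<close> for each \<open>k\<close> separately,
  without regularity in \<open>k\<close>; holomorphy can be recovered because for Im k > 0 the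
  normalisation at infinity determines the solution.

  The factor |Re k| stems from |Im \<zeta>^2| = 2 Im k |Re k|. Some loss on the imaginary axis is
  unavoidable, since k0^2 may be a negative eigenvalue there. The loss is linear, and k0 is
  approached horizontally in the direction away from the axis, where |k - k0| <= |Re k|, so one
  power of k - k0 compensates it. The estimate is made for the adjoint because the adjoint acts on
  columns of \<open>F\<close> itself, and for square matrices injectivity of the adjoint suffices
  for invertibility.\<close>

section \<open>Indefinite integrals of integrable functions\<close>

text \<open>As a function of \<open>\<mu>\<close> instead of \<open>t\<close>, the map \<open>E\<close> has derivative zero.\<close>
lemma constant_if_quadratically_dominated:
  fixes E :: "real \<Rightarrow> 'a::real_normed_vector" and \<mu> :: "real \<Rightarrow> real"
  assumes ab: "a \<le> b" and cont: "continuous_on {a..b} \<mu>" and mono: "mono_on {a..b} \<mu>"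
    and bound: "\<And>s t. \<lbrakk>a \<le> s; s \<le> t; t \<le> b\<rbrakk> \<Longrightarrow> norm (E t - E s) \<le> C * (\<mu> t - \<mu> s)\<^sup>2"
  shows "E b = E a"
proof -
  have sym: "norm (E t - E s) \<le> C * (\<mu> t - \<mu> s)\<^sup>2" if "s \<in> {a..b}" "t \<in> {a..b}" for s t
    using bound[of s t] bound[of t s] that
    by (cases "s \<le> t") (auto simp: norm_minus_commute power2_commute)
  define \<phi> where "\<phi> y = E (inv_into {a..b} \<mu> y)" for y
  have img: "\<mu> ` {a..b} = {\<mu> a..\<mu> b}"
  proof
    show "\<mu> ` {a..b} \<subseteq> {\<mu> a..\<mu> b}"
      using mono ab by (auto simp: mono_on_def)
    show "{\<mu> a..\<mu> b} \<subseteq> \<mu> ` {a..b}"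
      using IVT'[of \<mu> a _ b] cont ab by (fastforce simp: image_iff)
  qed
  \<comment> \<open>Points with equal \<open>\<mu>\<close> have equal \<open>E\<close> by the bound,
    so it does not matter which preimage \<open>inv_into\<close> picks.\<close>
  have phi: "\<phi> (\<mu> t) = E t" if "t \<in> {a..b}" for t
  proof -
    have "inv_into {a..b} \<mu> (\<mu> t) \<in> {a..b}" "\<mu> (inv_into {a..b} \<mu> (\<mu> t)) = \<mu> t"
      using that by (auto intro: inv_into_into f_inv_into_f simp del: atLeastAtMost_iff)
    then show ?thesis
      using sym[of t "inv_into {a..b} \<mu> (\<mu> t)"] that by (simp add: \<phi>_def)
  qed
  have phib: "norm (\<phi> y - \<phi> x) \<le> C * (y - x)\<^sup>2" if "x \<in> {\<mu> a..\<mu> b}" "y \<in> {\<mu> a..\<mu> b}" for x y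
    using that phi sym unfolding img[symmetric] by auto
  have "(\<phi> has_derivative (\<lambda>h. 0)) (at x within {\<mu> a..\<mu> b})" if x: "x \<in> {\<mu> a..\<mu> b}" for x
  proof (rule has_derivativeI_sandwich[of 1])
    show "((\<lambda>y. C * norm (y - x)) \<longlongrightarrow> 0) (at x within {\<mu> a..\<mu> b})"
      by (rule tendsto_eq_intros refl | simp)+
    show "norm (\<phi> y - \<phi> x - 0) / norm (y - x) \<le> C * norm (y - x)"
      if "y \<in> {\<mu> a..\<mu> b}" "y \<noteq> x" for y
      using phib[OF x that(1)] that by (simp add: divide_le_eq power2_eq_square mult.assoc abs_mult_self_eq)
  qed auto
  then obtain c where "\<And>x. x \<in> {\<mu> a..\<mu> b} \<Longrightarrow> \<phi> x = c"
    using has_derivative_zero_constant[of "{\<mu> a..\<mu> b}" \<phi>] by auto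
  then show ?thesis
    using phi[of a] phi[of b] img ab by (metis atLeastAtMost_iff image_eqI order_refl)
qed

lemma absolutely_integrable_bounded_bilinear:
  fixes h :: "'a::euclidean_space \<Rightarrow> 'b::euclidean_space \<Rightarrow> 'c::euclidean_space" and S :: "real set"
  assumes h: "bounded_bilinear h" and "continuous_on S f" "S \<in> sets lebesgue" "bounded (f ` S)"
    and "g absolutely_integrable_on S"
  shows "(\<lambda>x. h (f x) (g x)) absolutely_integrable_on S"
  by (rule absolutely_integrable_bounded_measurable_product)
     (use assms in \<open>auto intro: continuous_imp_measurable_on_sets_lebesgue simp: bilinear_conv_bounded_bilinear\<close>)

lemma absolutely_integrable_bilinear_interval:
  fixes h :: "'a::euclidean_space \<Rightarrow> 'b::euclidean_space \<Rightarrow> 'c::euclidean_space" and a b :: real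
  assumes h: "bounded_bilinear h" and "continuous_on {a..b} f"
    and "g absolutely_integrable_on {a..b}"
  shows "(\<lambda>x. h (f x) (g x)) absolutely_integrable_on {a..b}"
  by (rule absolutely_integrable_bounded_bilinear[OF assms(1,2)])
     (use assms compact_imp_bounded[OF compact_continuous_image[OF assms(2)]] in auto)

lemma integrable_on_subset_of_absolutely_integrable:
  fixes f :: "'a::euclidean_space \<Rightarrow> 'b::euclidean_space"
  assumes "f absolutely_integrable_on S" "T \<in> sets lebesgue" "T \<subseteq> S"
  shows "f integrable_on T"
  using set_integrable_subset[OF assms] by (rule set_lebesgue_integral_eq_integral(1))

lemma integral_diff_initial_segments:
  fixes f :: "real \<Rightarrow> 'a::euclidean_space"
  assumes f: "f absolutely_integrable_on {a..b}" and st: "a \<le> s" "s \<le> t" "t \<le> b"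
  shows "integral {a..t} f - integral {a..s} f = integral {s..t} f"
proof -
  have "f integrable_on {a..t}"
    by (rule integrable_on_subset_of_absolutely_integrable[OF f]) (use st in auto)
  from Henstock_Kurzweil_Integration.integral_combine[OF st(1,2) this] show ?thesis
    by (simp add: algebra_simps)
qed

text \<open>Integration by parts for absolutely continuous \<open>P\<close> and \<open>R\<close>,
  without differentiating them almost everywhere. The defect \<open>E\<close> changes over [s,t] by
  an integral of products of \<open>p\<close> or \<open>r\<close> with an increment of
  \<open>R\<close> or \<open>P\<close>. With \<open>\<mu>\<close> the integral of |p| + |r| this is
  at most \<open>K\<close> times the squared increment of \<open>\<mu>\<close>, so the preceding
  criterion makes \<open>E\<close> constant.\<close>

lemma product_rule_indefinite_integrals:
  fixes h :: "'a::euclidean_space \<Rightarrow> 'b::euclidean_space \<Rightarrow> 'c::euclidean_space"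
    and p :: "real \<Rightarrow> 'a" and r :: "real \<Rightarrow> 'b"
  assumes h: "bounded_bilinear h" and ab: "a \<le> b"
    and p: "p absolutely_integrable_on {a..b}" and r: "r absolutely_integrable_on {a..b}"
    and P: "\<And>x. x \<in> {a..b} \<Longrightarrow> (p has_integral (P x - P a)) {a..x}"
    and R: "\<And>x. x \<in> {a..b} \<Longrightarrow> (r has_integral (R x - R a)) {a..x}"
  shows "((\<lambda>t. h (p t) (R t) + h (P t) (r t)) has_integral (h (P b) (R b) - h (P a) (R a))) {a..b}"
proof -
  interpret bounded_bilinear h by fact
  obtain K where K: "0 < K" "\<And>x y. norm (h x y) \<le> norm x * norm y * K"
    using pos_bounded by auto
  have hs: "bounded_bilinear (\<lambda>x y. h y x)" by (rule flip)
  have Pe: "P x = P a + integral {a..x} p" "R x = R a + integral {a..x} r" if "x \<in> {a..b}" for x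
    using P[OF that] R[OF that] by (auto dest!: integral_unique)
  have ip: "p integrable_on {a..b}" "r integrable_on {a..b}"
    using p r by (auto simp: absolutely_integrable_on_def)
  have "continuous_on {a..b} (\<lambda>x. P a + integral {a..x} p)" "continuous_on {a..b} (\<lambda>x. R a + integral {a..x} r)"
    by (rule continuous_on_add[OF continuous_on_const indefinite_integral_continuous_1], rule ip)+
  then have cP: "continuous_on {a..b} P" and cR: "continuous_on {a..b} R"
    using Pe by (metis (mono_tags, lifting) continuous_on_cong)+
  define g where "g t = h (p t) (R t) + h (P t) (r t)" for t
  have g: "g absolutely_integrable_on {a..b}"
    unfolding g_def using absolutely_integrable_bilinear_interval[OF hs cR p]
       absolutely_integrable_bilinear_interval[OF h cP r] by (intro set_integral_add)
  define n where "n t = norm (p t) + norm (r t)" for t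
  have n: "n absolutely_integrable_on {a..b}"
    unfolding n_def by (rule set_integral_add(1)[OF set_integrable_norm[OF p] set_integrable_norm[OF r]])
  then have ni: "n integrable_on {a..b}" by (simp add: absolutely_integrable_on_def)
  define \<mu> where "\<mu> x = integral {a..x} n" for x
  define E where "E x = h (P x) (R x) - integral {a..x} g" for x
  note sub = integrable_on_subset_of_absolutely_integrable and diff = integral_diff_initial_segments
  have mu: "\<mu> t - \<mu> s = integral {s..t} n" if "a \<le> s" "s \<le> t" "t \<le> b" for s t
    unfolding \<mu>_def using diff[OF n that] .
  have mm: "\<mu> s \<le> \<mu> t" if "a \<le> s" "s \<le> t" "t \<le> b" for s t
  proof -
    have "0 \<le> integral {s..t} n" by (rule integral_nonneg[OF sub[OF n]]) (use that in \<open>auto simp: n_def\<close>)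
    then show ?thesis using mu[OF that] by simp
  qed
  have dP: "norm (P t - P s) \<le> \<mu> t - \<mu> s" "norm (R t - R s) \<le> \<mu> t - \<mu> s"
      if "a \<le> s" "s \<le> t" "t \<le> b" for s t
  proof -
    have "P t - P s = integral {s..t} p" "R t - R s = integral {s..t} r"
      using Pe[of t] Pe[of s] diff[OF p that] diff[OF r that] that by auto
    moreover have "norm (integral {s..t} p) \<le> integral {s..t} n" "norm (integral {s..t} r) \<le> integral {s..t} n"
      using that
      by (auto intro!: integral_norm_bound_integral sub[OF n] sub[OF p] sub[OF r] simp: n_def)
    ultimately show "norm (P t - P s) \<le> \<mu> t - \<mu> s" "norm (R t - R s) \<le> \<mu> t - \<mu> s"
      using mu[OF that] by auto
  qed
  have "E b = E a"
  proof (rule constant_if_quadratically_dominated[where \<mu> = \<mu> and C = K])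
    show "a \<le> b" by fact
    show "continuous_on {a..b} \<mu>" unfolding \<mu>_def by (rule indefinite_integral_continuous_1[OF ni])
    show "mono_on {a..b} \<mu>" using mm by (auto simp: mono_on_def)
    fix s t assume st: "a \<le> s" "s \<le> t" "t \<le> b"
    have ip: "(p has_integral (P t - P s)) {s..t}" "(r has_integral (R t - R s)) {s..t}"
      using Pe[of t] Pe[of s] diff[OF p st] diff[OF r st] sub[OF p, of "{s..t}"] sub[OF r, of "{s..t}"] st
      by (auto simp: has_integral_iff)
    have ig: "(g has_integral (integral {a..t} g - integral {a..s} g)) {s..t}"
      using diff[OF g st] sub[OF g, of "{s..t}"] st by (auto simp: has_integral_iff)
    \<comment> \<open>Freezing \<open>R\<close> at \<open>t\<close> and \<open>P\<close> at
      \<open>s\<close> makes the two increments telescope to h (P t) (R t) - h (P s) (R s).\<close>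
    have "((\<lambda>\<tau>. h (p \<tau>) (R t) + h (P s) (r \<tau>) - g \<tau>) has_integral
       (h (P t - P s) (R t) + h (P s) (R t - R s) - (integral {a..t} g - integral {a..s} g))) {s..t}"
      using has_integral_linear[OF ip(1) bounded_linear_left[of "R t"]] has_integral_linear[OF ip(2) bounded_linear_right[of "P s"]]
      by (intro has_integral_diff has_integral_add ig) (auto simp: o_def)
    moreover have "h (P t - P s) (R t) + h (P s) (R t - R s) - (integral {a..t} g - integral {a..s} g) = E t - E s"
      by (simp add: E_def diff_left diff_right)
    moreover have "(\<lambda>\<tau>. h (p \<tau>) (R t) + h (P s) (r \<tau>) - g \<tau>) = (\<lambda>\<tau>. h (p \<tau>) (R t - R \<tau>) + h (P s - P \<tau>) (r \<tau>))"
      by (auto simp: g_def diff_left diff_right)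
    ultimately have I: "((\<lambda>\<tau>. h (p \<tau>) (R t - R \<tau>) + h (P s - P \<tau>) (r \<tau>)) has_integral (E t - E s)) {s..t}"
      by simp
    have "norm (integral {s..t} (\<lambda>\<tau>. h (p \<tau>) (R t - R \<tau>) + h (P s - P \<tau>) (r \<tau>))) \<le>
          integral {s..t} (\<lambda>\<tau>. K * (\<mu> t - \<mu> s) * n \<tau>)"
    proof (rule integral_norm_bound_integral)
      show "(\<lambda>\<tau>. K * (\<mu> t - \<mu> s) * n \<tau>) integrable_on {s..t}"
        using sub[OF n, of "{s..t}"] st by (intro integrable_on_mult_right) auto
      fix \<tau> assume \<tau>: "\<tau> \<in> {s..t}"
      have "norm (h (p \<tau>) (R t - R \<tau>)) \<le> norm (p \<tau>) * (\<mu> t - \<mu> s) * K"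
        using dP(2)[of \<tau> t] mm[of s \<tau>] \<tau> st K(1)
        by (intro order_trans[OF K(2)] mult_right_mono mult_left_mono) auto
      moreover have "norm (h (P s - P \<tau>) (r \<tau>)) \<le> (\<mu> t - \<mu> s) * norm (r \<tau>) * K"
        using dP(1)[of s \<tau>] mm[of \<tau> t] \<tau> st K(1)
        by (intro order_trans[OF K(2)] mult_right_mono mult_left_mono) (auto simp: norm_minus_commute)
      ultimately show "norm (h (p \<tau>) (R t - R \<tau>) + h (P s - P \<tau>) (r \<tau>)) \<le> K * (\<mu> t - \<mu> s) * n \<tau>"
        by (intro order_trans[OF norm_triangle_ineq]) (auto simp: n_def algebra_simps)
    qed (use I in \<open>auto simp: has_integral_iff\<close>)
    then show "norm (E t - E s) \<le> K * (\<mu> t - \<mu> s)\<^sup>2"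
      using I mu[OF st] by (simp add: has_integral_iff power2_eq_square)
  qed
  then have "integral {a..b} g = h (P b) (R b) - h (P a) (R a)"
    by (simp add: E_def algebra_simps)
  then show ?thesis
    using g unfolding g_def[symmetric] by (auto simp: has_integral_iff absolutely_integrable_on_def)
qed

section \<open>Half-line integrals as functions of the lower endpoint\<close>

lemma integral_atLeast_split:
  fixes h :: "real \<Rightarrow> 'a::euclidean_space"
  assumes "h absolutely_integrable_on {a..}" "a \<le> x" "x \<le> y"
  shows "integral {x..} h = integral {x..y} h + integral {y..} h"
proof -
  have i: "h integrable_on {x..y}" "h integrable_on {y..}"
    using set_integrable_subset[OF assms(1), of "{x..y}"] set_integrable_subset[OF assms(1), of "{y..}"] assms
    by (auto intro!: set_lebesgue_integral_eq_integral(1))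
  have "{x..} = {x..y} \<union> {y..}" "{x..y} \<inter> {y..} = {y}" using assms by auto
  then show ?thesis
    using Henstock_Kurzweil_Integration.integral_Un[OF i] by (auto)
qed

lemma integral_atLeast_tendsto_0:
  fixes h :: "real \<Rightarrow> 'a::euclidean_space"
  assumes "h absolutely_integrable_on {a..}"
  shows "((\<lambda>x. integral {x..} h) \<longlongrightarrow> 0) at_top"
proof -
  have "((\<lambda>y. LINT x:{a..y}|lebesgue. h x) \<longlongrightarrow> (LINT x:{a..}|lebesgue. h x)) at_top"
    by (rule tendsto_set_lebesgue_integral_at_top) (use assms in auto)
  then have "((\<lambda>y. (LINT x:{a..}|lebesgue. h x) - (LINT x:{a..y}|lebesgue. h x)) \<longlongrightarrow> 0) at_top"
    by (auto intro!: tendsto_eq_intros)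
  moreover have "eventually (\<lambda>y. (LINT x:{a..}|lebesgue. h x) - (LINT x:{a..y}|lebesgue. h x) = integral {y..} h) at_top"
    using eventually_ge_at_top[of a]
  proof eventually_elim
    case (elim y)
    have "h absolutely_integrable_on {a..y}" using set_integrable_subset[OF assms(1), of "{a..y}"] by auto
    then show ?case using assms integral_atLeast_split[OF assms, of a y] elim
      by (simp add: set_lebesgue_integral_eq_integral)
  qed
  ultimately show ?thesis by (rule Lim_transform_eventually)
qed

lemma continuous_on_integral_atLeast:
  fixes h :: "real \<Rightarrow> 'a::euclidean_space"
  assumes "h absolutely_integrable_on {a..}"
  shows "continuous_on {a..} (\<lambda>x. integral {x..} h)"
proof -
  have "continuous_on {a..b} (\<lambda>x. integral {x..} h)" for b
  proof -
    have "h integrable_on {a..b}" using set_integrable_subset[OF assms(1), of "{a..b}"]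
      by (auto intro!: set_lebesgue_integral_eq_integral(1))
    then have "continuous_on {a..b} (\<lambda>x. integral {a..} h - integral {a..x} h)"
      by (intro continuous_intros indefinite_integral_continuous_1)
    moreover have "integral {a..} h - integral {a..x} h = integral {x..} h" if "x \<in> {a..b}" for x
      using integral_atLeast_split[OF assms, of a x] that by auto
    ultimately show ?thesis by (metis (mono_tags, lifting) continuous_on_cong)
  qed
  then have "continuous (at x within {a..}) (\<lambda>x. integral {x..} h)" if "x \<in> {a..}" for x
    using that at_within_nhd[of x "{..<x+1}" "{a..}" "{a..x+1}"]
    by (fastforce simp: continuous_on_eq_continuous_within)
  then show ?thesis
    by (simp add: continuous_on_eq_continuous_within)
qed

section \<open>Complex vectors and holomorphic parameter integrals\<close>

lemma norm_vector_smult: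
  fixes v :: "complex^'n"
  shows "norm (c *s v) = norm c * norm v"
  by (simp add: norm_vec_def norm_mult L2_set_right_distrib)

lemma bounded_bilinear_vector_smult:
  "bounded_bilinear ((*s) :: complex \<Rightarrow> complex^'n \<Rightarrow> complex^'n)"
proof
  show "\<exists>K. \<forall>a (b :: complex^'n). norm (a *s b) \<le> norm a * norm b * K"
    by (rule exI[of _ 1]) (simp add: norm_vector_smult)
qed (auto simp: vec_eq_iff algebra_simps)

lemma norm_matrix_vector_mult_le:
  fixes A :: "complex^'n^'m"
  shows "norm (A *v x) \<le> norm A * norm x"
proof -
  have "norm ((A *v x) $ i) \<le> norm (A $ i) * norm x" for i
  proof -
    have "norm ((A *v x) $ i) \<le> (\<Sum>j\<in>UNIV. norm (A $ i $ j) * norm (x $ j))"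
      unfolding matrix_vector_mult_def by (auto simp: norm_mult intro!: sum_norm_le)
    also have "\<dots> \<le> norm (A $ i) * norm x"
      unfolding norm_vec_def[of "A $ i"] norm_vec_def[of x]
      using L2_set_mult_ineq[of "\<lambda>j. norm (A $ i $ j)" "\<lambda>j. norm (x $ j)" UNIV] by simp
    finally show ?thesis .
  qed
  then have "norm (A *v x) \<le> L2_set (\<lambda>i. norm (A $ i) * norm x) UNIV"
    unfolding norm_vec_def[of "A *v x"] by (intro L2_set_mono) auto
  also have "\<dots> = norm A * norm x"
    unfolding norm_vec_def[of A] by (subst L2_set_left_distrib) auto
  finally show ?thesis .
qed

lemma bounded_bilinear_matrix_vector_mult:
  "bounded_bilinear ((*v) :: complex^'n^'m \<Rightarrow> complex^'n \<Rightarrow> complex^'m)"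
proof
  show "\<exists>K. \<forall>a b. norm ((a :: complex^'n^'m) *v b) \<le> norm a * norm b * K"
    by (rule exI[of _ 1]) (simp add: norm_matrix_vector_mult_le)
qed (auto simp: vec_eq_iff matrix_vector_mult_def sum.distrib algebra_simps scaleR_sum_right)

text \<open>By Cauchy's inequality a dominating function for the values also dominates the
  difference quotients, up to a factor 1/d, so dominated convergence permits differentiation under
  the integral.\<close>

lemma holomorphic_on_integral_parameter:
  fixes \<phi> :: "real \<Rightarrow> complex \<Rightarrow> complex"
  assumes int: "\<And>k. k \<in> ball k0 r \<Longrightarrow> (\<lambda>t. \<phi> t k) integrable_on S"
    and holo: "\<And>t. t \<in> S \<Longrightarrow> \<phi> t holomorphic_on ball k0 r"
    and g: "g integrable_on S"
    and dom: "\<And>t k. \<lbrakk>t \<in> S; k \<in> ball k0 r\<rbrakk> \<Longrightarrow> norm (\<phi> t k) \<le> g t"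
  shows "(\<lambda>k. integral S (\<lambda>t. \<phi> t k)) holomorphic_on ball k0 r"
proof (rule holomorphic_onI)
  fix k assume k: "k \<in> ball k0 r"
  \<comment> \<open>The radius \<open>2*d\<close> leaves room for a disc of radius \<open>d\<close>
    around each point of \<open>ball k d\<close>.\<close>
  obtain d where d: "d > 0" "cball k (2*d) \<subseteq> ball k0 r"
  proof -
    obtain e where "e > 0" "cball k e \<subseteq> ball k0 r"
      using k open_ball open_contains_cball by blast
    then show ?thesis using that[of "e/2"] by simp
  qed
  have dq: "norm (\<phi> t z - \<phi> t k) \<le> g t / d * norm (z - k)" if t: "t \<in> S" and z: "z \<in> ball k d" for t z
  proof (rule field_differentiable_bound[of "ball k d" "\<phi> t" "deriv (\<phi> t)"])
    fix w assume w: "w \<in> ball k d"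
    then have "w \<in> cball k (2*d)" using d(1) by simp
    with d(2) have wk: "w \<in> ball k0 r" by blast
    have sub: "cball w d \<subseteq> cball k (2*d)"
    proof
      fix x assume "x \<in> cball w d"
      then show "x \<in> cball k (2*d)" using w dist_triangle[of k x w] by auto
    qed
    show "(\<phi> t has_field_derivative deriv (\<phi> t) w) (at w within ball k d)"
      by (rule has_field_derivative_at_within, rule holomorphic_derivI[OF holo[OF t] open_ball wk])
    have "norm ((deriv ^^ 1) (\<phi> t) w) \<le> fact 1 * g t / d ^ 1"
    proof (rule Cauchy_inequality)
      show "\<phi> t holomorphic_on ball w d" "continuous_on (cball w d) (\<phi> t)"
        using holo[OF t] sub d(2) ball_subset_cball[of w d]
        by (meson holomorphic_on_imp_continuous_on holomorphic_on_subset subset_trans)+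
      show "norm (\<phi> t x) \<le> g t" if "norm (w - x) = d" for x
      proof -
        have "x \<in> cball w d" using that by (simp add: dist_norm)
        then show ?thesis using sub d(2) dom[OF t] by blast
      qed
    qed (use d in auto)
    then show "norm (deriv (\<phi> t) w) \<le> g t / d" by simp
  qed (use z d in auto)
  have lim: "((\<lambda>z. (\<phi> t z - \<phi> t k) / (z - k)) \<longlongrightarrow> deriv (\<phi> t) k) (at k)" if "t \<in> S" for t
    using holomorphic_derivI[OF holo[OF that] open_ball k] by (simp add: has_field_derivative_iff)
  have "((\<lambda>z. (integral S (\<lambda>t. \<phi> t z) - integral S (\<lambda>t. \<phi> t k)) / (z - k)) \<longlongrightarrow>
         integral S (\<lambda>t. deriv (\<phi> t) k)) (at k)"
    unfolding tendsto_at_iff_sequentially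
  proof (intro allI impI)
    fix X assume X: "\<forall>i. X i \<in> UNIV - {k}" "X \<longlonglongrightarrow> k"
    have "eventually (\<lambda>n. X n \<in> ball k d) sequentially"
      using tendstoD[OF X(2) d(1)] by (simp add: dist_commute)
    then obtain N where N: "\<And>n. n \<ge> N \<Longrightarrow> X n \<in> ball k d"
      by (auto simp: eventually_sequentially)
    have "ball k d \<subseteq> cball k (2*d)" using d(1) by auto
    with d(2) have kd: "ball k d \<subseteq> ball k0 r" by blast
    \<comment> \<open>Dominated convergence needs the bound for every member of the sequence, so the
      first \<open>N\<close> are dropped.\<close>
    have XN: "X (n + N) \<in> ball k0 r" "X (n + N) \<in> ball k d" "X (n + N) \<noteq> k" for n
      using N[of "n+N"] subsetD[OF kd] X(1) by auto
    have XL: "(\<lambda>n. X (n + N)) \<longlonglongrightarrow> k" using X(2) by (rule LIMSEQ_ignore_initial_segment)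
    have "(\<lambda>n. integral S (\<lambda>t. (\<phi> t (X (n + N)) - \<phi> t k) / (X (n + N) - k))) \<longlonglongrightarrow> integral S (\<lambda>t. deriv (\<phi> t) k)"
    proof (rule dominated_convergence(2))
      show "(\<lambda>t. (\<phi> t (X (n + N)) - \<phi> t k) / (X (n + N) - k)) integrable_on S" for n
        using int[OF XN(1)] int[OF k] by (intro integrable_on_divide integrable_diff)
      show "(\<lambda>t. g t / d) integrable_on S" using g by (rule integrable_on_divide)
      show "norm ((\<phi> t (X (n + N)) - \<phi> t k) / (X (n + N) - k)) \<le> g t / d" if "t \<in> S" for n t
        using dq[OF that XN(2)[of n]] XN(3)[of n] by (simp add: norm_divide divide_le_eq)
      show "(\<lambda>n. (\<phi> t (X (n + N)) - \<phi> t k) / (X (n + N) - k)) \<longlonglongrightarrow> deriv (\<phi> t) k" if "t \<in> S" for t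
        using lim[OF that] XL XN(3) unfolding tendsto_at_iff_sequentially comp_def
        by (elim allE[of _ "\<lambda>n. X (n + N)"]) auto
    qed
    also have "(\<lambda>n. integral S (\<lambda>t. (\<phi> t (X (n + N)) - \<phi> t k) / (X (n + N) - k))) =
        (\<lambda>n. (integral S (\<lambda>t. \<phi> t (X (n + N))) - integral S (\<lambda>t. \<phi> t k)) / (X (n + N) - k))"
      by (rule ext, subst integral_divide,
          subst Henstock_Kurzweil_Integration.integral_diff[OF int[OF XN(1)] int[OF k]], rule refl)
    finally show "((\<lambda>z. (integral S (\<lambda>t. \<phi> t z) - integral S (\<lambda>t. \<phi> t k)) / (z - k)) \<circ> X) \<longlonglongrightarrow> integral S (\<lambda>t. deriv (\<phi> t) k)"
      unfolding o_def by (rule LIMSEQ_offset)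
  qed
  then have "((\<lambda>k. integral S (\<lambda>t. \<phi> t k)) has_field_derivative integral S (\<lambda>t. deriv (\<phi> t) k)) (at k)"
    by (rule iffD2[OF has_field_derivative_iff])
  then show "(\<lambda>k. integral S (\<lambda>t. \<phi> t k)) field_differentiable at k within ball k0 r"
    unfolding field_differentiable_def by (blast intro: has_field_derivative_at_within)
qed

text \<open>The tail q has derivative -g in the integrated sense, so -q^(n+1)/(n+1) is a primitive
  of g q^n, and q vanishes at infinity. The factors 1/(n+1) gained here multiply to the 1/n! of the
  Neumann series, which therefore converges without smallness of \<open>Q\<close>.\<close>

lemma integral_times_tail_power:
  fixes g :: "real \<Rightarrow> real"
  assumes g: "g absolutely_integrable_on {a..}" and ax: "a \<le> x"
  shows "((\<lambda>t. g t * integral {t..} g ^ n) has_integral (integral {x..} g ^ Suc n / real (Suc n))) {x..}"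
    and "(\<lambda>t. g t * integral {t..} g ^ n) absolutely_integrable_on {x..}"
proof -
  define q where "q t = integral {t..} g" for t
  have gx: "g absolutely_integrable_on {x..}" using g ax by (auto intro: set_integrable_subset)
  have cq: "continuous_on {x..} q"
    unfolding q_def by (rule continuous_on_integral_atLeast[OF gx])
  have base: "((\<lambda>t. - g t) has_integral (q y - q x)) {x..y}" if "x \<le> y" for y
  proof -
    have "g integrable_on {x..y}"
      by (rule integrable_on_subset_of_absolutely_integrable[OF gx]) auto
    then have "((\<lambda>t. - g t) has_integral - integral {x..y} g) {x..y}"
      by (intro has_integral_neg integrable_integral)
    then show ?thesis
      using integral_atLeast_split[OF g ax that] by (simp add: q_def)
  qed
  \<comment> \<open>Since \<open>q\<close> is only absolutely continuous, the power rule is built by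
    induction from the product rule.\<close>
  have step: "((\<lambda>t. - real (Suc n) * (g t * q t ^ n)) has_integral (q y ^ Suc n - q x ^ Suc n)) {x..y}"
    if "x \<le> y" for y n
    using that
  proof (induction n arbitrary: y)
    case 0
    then show ?case using base by simp
  next
    case (Suc n)
    have aq: "(\<lambda>t. - real (Suc n) * (g t * q t ^ n)) absolutely_integrable_on {x..y}"
    proof -
      have "(\<lambda>t. (- real (Suc n) * q t ^ n) * g t) absolutely_integrable_on {x..y}"
        by (rule absolutely_integrable_bilinear_interval[OF bounded_bilinear_mult])
           (use cq gx in \<open>auto intro!: continuous_intros intro: continuous_on_subset set_integrable_subset\<close>)
      then show ?thesis by (simp add: mult_ac)
    qed
    have ag: "(\<lambda>t. - g t) absolutely_integrable_on {x..y}"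
      using absolutely_integrable_scaleR_left[OF set_integrable_subset[OF gx, of "{x..y}"], of "-1"] by auto
    have "((\<lambda>t. - real (Suc n) * (g t * q t ^ n) * q t + q t ^ Suc n * - g t) has_integral
         (q y ^ Suc n * q y - q x ^ Suc n * q x)) {x..y}"
      by (rule product_rule_indefinite_integrals[OF bounded_bilinear_mult Suc.prems aq ag])
         (use Suc.IH base in auto)
    moreover have "(\<lambda>t. - real (Suc n) * (g t * q t ^ n) * q t + q t ^ Suc n * - g t) = (\<lambda>t. - real (Suc (Suc n)) * (g t * q t ^ Suc n))"
      by (auto simp: algebra_simps)
    ultimately show ?case by (simp add: mult_ac)
  qed
  have bq: "bounded (q ` {x..})"
  proof -
    have "norm (q t) \<le> integral {x..} (\<lambda>t. norm (g t))" if "t \<ge> x" for t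
    proof -
      have n: "(\<lambda>t. norm (g t)) absolutely_integrable_on {x..}" by (rule set_integrable_norm[OF gx])
      have "norm (q t) \<le> integral {t..} (\<lambda>t. norm (g t))"
        unfolding q_def using that
        by (intro integral_norm_bound_integral set_lebesgue_integral_eq_integral(1) set_integrable_subset[OF gx] set_integrable_subset[OF n]) auto
      also have "\<dots> \<le> integral {x..} (\<lambda>t. norm (g t))"
        using that by (intro integral_subset_le set_lebesgue_integral_eq_integral(1) set_integrable_subset[OF n]) auto
      finally show ?thesis .
    qed
    then show ?thesis unfolding bounded_iff by blast
  qed
  then obtain B where B: "\<And>t. t \<ge> x \<Longrightarrow> norm (q t) \<le> B" unfolding bounded_iff by auto
  have "(\<lambda>t. (q t ^ n) * g t) absolutely_integrable_on {x..}"
  proof (rule absolutely_integrable_bounded_bilinear[OF bounded_bilinear_mult _ _ _ gx])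
    have "norm (q t ^ n) \<le> B ^ n" if "t \<ge> x" for t
      using power_mono[OF B[OF that] norm_ge_zero, of n] by (simp only: norm_power)
    then show "bounded ((\<lambda>t. q t ^ n) ` {x..})" unfolding bounded_iff by auto
  qed (use cq in \<open>auto intro!: continuous_intros\<close>)
  then have ab: "(\<lambda>t. g t * q t ^ n) absolutely_integrable_on {x..}" by (simp add: mult_ac)
  then show "(\<lambda>t. g t * integral {t..} g ^ n) absolutely_integrable_on {x..}" by (simp add: q_def)
  have "integral {x..} (\<lambda>t. g t * q t ^ n) = q x ^ Suc n / real (Suc n)"
  proof (rule tendsto_unique[of at_top])
    show "((\<lambda>y. q x ^ Suc n / real (Suc n) - q y ^ Suc n / real (Suc n) + integral {y..} (\<lambda>t. g t * q t ^ n)) \<longlongrightarrow> q x ^ Suc n / real (Suc n)) at_top"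
      using integral_atLeast_tendsto_0[OF ab] integral_atLeast_tendsto_0[OF g]
      unfolding q_def by (auto intro!: tendsto_eq_intros)
    have "eventually (\<lambda>y. integral {x..} (\<lambda>t. g t * q t ^ n) =
        q x ^ Suc n / real (Suc n) - q y ^ Suc n / real (Suc n) + integral {y..} (\<lambda>t. g t * q t ^ n)) at_top"
      using eventually_ge_at_top[of x]
    proof eventually_elim
      case (elim y)
      have "integral {x..y} (\<lambda>t. - real (Suc n) * (g t * q t ^ n)) = q y ^ Suc n - q x ^ Suc n"
        using step[OF elim] by (rule integral_unique)
      then have "- real (Suc n) * integral {x..y} (\<lambda>t. g t * q t ^ n) = q y ^ Suc n - q x ^ Suc n"
        by (simp only: integral_mult_right)
      then have "integral {x..y} (\<lambda>t. g t * q t ^ n) = - (q y ^ Suc n - q x ^ Suc n) / real (Suc n)"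
        by (simp add: field_simps del: power_Suc of_nat_Suc)
      then show ?case using integral_atLeast_split[OF ab order_refl elim]
        by (simp add: diff_divide_distrib del: power_Suc of_nat_Suc)
    qed
    then show "((\<lambda>y. q x ^ Suc n / real (Suc n) - q y ^ Suc n / real (Suc n) + integral {y..} (\<lambda>t. g t * q t ^ n)) \<longlongrightarrow> integral {x..} (\<lambda>t. g t * q t ^ n)) at_top"
      by (rule Lim_transform_eventually[OF tendsto_const])
  qed auto
  then show "((\<lambda>t. g t * integral {t..} g ^ n) has_integral (integral {x..} g ^ Suc n / real (Suc n))) {x..}"
    using ab by (simp add: q_def has_integral_iff set_lebesgue_integral_eq_integral(1))
qed

section \<open>The Volterra equation of a Jost vector\<close>

lemma has_integral_subsegment:
  fixes p :: "real \<Rightarrow> 'a::euclidean_space"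
  assumes P: "\<And>x. x \<ge> 0 \<Longrightarrow> (p has_integral (P x - P 0)) {0..x}" and ab: "0 \<le> a" "a \<le> b"
  shows "(p has_integral (P b - P a)) {a..b}"
proof -
  have b: "(p has_integral (P b - P 0)) {0..b}" and a: "(p has_integral (P a - P 0)) {0..a}"
    using P[of b] P[of a] ab by simp_all
  have i: "p integrable_on {a..b}"
    by (rule integrable_on_subinterval[of _ "{0..b}"]) (use b ab in \<open>auto simp: has_integral_iff\<close>)
  have "integral {0..a} p + integral {a..b} p = integral {0..b} p"
    using ab b by (intro Henstock_Kurzweil_Integration.integral_combine) (auto simp: has_integral_iff)
  then have "integral {a..b} p = integral {0..b} p - integral {0..a} p" by (simp add: algebra_simps)
  then have "integral {a..b} p = P b - P a"
    unfolding integral_unique[OF a] integral_unique[OF b] by simp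
  with i show ?thesis by (simp add: has_integral_iff)
qed

lemma bounded_image_atLeast_if_tendsto:
  fixes u :: "real \<Rightarrow> 'a::real_normed_vector"
  assumes c: "continuous_on {a..} u" and l: "(u \<longlongrightarrow> l) at_top"
  shows "bounded (u ` {a..})"
proof -
  have "eventually (\<lambda>x. dist (u x) l < 1) at_top" using l by (rule tendstoD) auto
  then obtain b where b: "\<And>x. x \<ge> b \<Longrightarrow> dist (u x) l < 1" by (auto simp: eventually_at_top_linorder)
  have "bounded (u ` {a..max a b})"
    by (intro compact_imp_bounded compact_continuous_image continuous_on_subset[OF c]) auto
  moreover have "bounded (u ` {b..})"
    unfolding bounded_def using b by (intro exI[of _ l] exI[of _ 1]) (auto simp: dist_commute less_imp_le)
  ultimately have "bounded (u ` {a..max a b} \<union> u ` {b..})" by simp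
  then show ?thesis unfolding image_Un[symmetric] by (rule bounded_subset, intro image_mono) auto
qed

lemma matrix_vector_mult_smult:
  fixes A :: "'a::comm_semiring_1^'n^'m"
  shows "A *v (c *s x) = c *s (A *v x)"
  by (simp add: vec_eq_iff matrix_vector_mult_def sum_distrib_left mult_ac)

lemma integral_vector_smult:
  fixes h :: "real \<Rightarrow> complex^'n"
  assumes "h integrable_on S"
  shows "integral S (\<lambda>t. c *s h t) = c *s integral S h"
  using integral_linear[OF assms bounded_bilinear.bounded_linear_right[OF bounded_bilinear_vector_smult]]
  by (simp add: o_def)

text \<open>For nonzero \<open>k\<close> this is the integral of exp(2ik\<sigma>) over [0,s], the
  Green function of m'' + 2ik m' = Q m, the equation satisfied by m = exp(-ikx) f.\<close>

definition jost_kernel :: "complex \<Rightarrow> real \<Rightarrow> complex" where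
  "jost_kernel k s = (exp (2 * \<i> * k * of_real s) - 1) / (2 * \<i> * k)"

text \<open>Not the derivative of \<open>jost_kernel\<close>, but \<open>\<i> * k\<close> times that
  kernel minus its derivative in \<open>s\<close>: the kernel belonging to exp(-ikx) f' = m' + ik
  m.\<close>

definition jost_kernel_deriv :: "complex \<Rightarrow> real \<Rightarrow> complex" where
  "jost_kernel_deriv k s = - (exp (2 * \<i> * k * of_real s) + 1) / 2"

lemma norm_exp_upper_half_le_1:
  assumes "Im k \<ge> 0" "s \<ge> 0"
  shows "norm (exp (2 * \<i> * k * of_real s)) \<le> 1"
  using assms by (simp add: norm_exp_eq_Re)

lemma norm_jost_kernel_le:
  assumes "Im k \<ge> 0" "s \<ge> 0"
  shows "norm (jost_kernel k s) \<le> 1 / norm k" "norm (jost_kernel_deriv k s) \<le> 1"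
proof -
  let ?e = "exp (2 * \<i> * k * of_real s)"
  have e: "norm ?e \<le> 1" by (rule norm_exp_upper_half_le_1[OF assms])
  have "norm (?e - 1) \<le> 2" using norm_triangle_ineq4[of ?e 1] e norm_one[where 'a=complex] by linarith
  then have "norm (?e - 1) / (2 * norm k) \<le> 2 / (2 * norm k)" by (intro divide_right_mono) auto
  then show "norm (jost_kernel k s) \<le> 1 / norm k"
    by (simp add: jost_kernel_def norm_divide norm_mult)
  have "norm (?e + 1) \<le> 2" using norm_triangle_ineq[of ?e 1] e norm_one[where 'a=complex] by linarith
  then show "norm (jost_kernel_deriv k s) \<le> 1"
    by (simp add: jost_kernel_deriv_def norm_divide norm_minus_commute del: minus_add_distrib)
qed

lemma continuous_on_jost_kernel [continuous_intros]:
  "continuous_on S (\<lambda>t. jost_kernel k (t - x))" "continuous_on S (\<lambda>t. jost_kernel_deriv k (t - x))"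
  unfolding jost_kernel_def jost_kernel_deriv_def divide_inverse by (intro continuous_intros)+

locale integrable_potential =
  fixes Q :: "real \<Rightarrow> complex^'n^'n"
  assumes Q: "Q absolutely_integrable_on {0..}"
begin

lemma absolutely_integrable_Q:
  assumes u: "continuous_on {x..} u" "bounded (u ` {x..})" and x: "0 \<le> x"
  shows "(\<lambda>t. Q t *v u t) absolutely_integrable_on {x..}"
proof -
  have "Q absolutely_integrable_on {x..}" by (rule set_integrable_subset[OF Q]) (use x in auto)
  then show ?thesis
    by (intro absolutely_integrable_bounded_bilinear[OF bounded_bilinear.flip[OF bounded_bilinear_matrix_vector_mult] u(1) _ u(2)]) auto
qed

lemma absolutely_integrable_kernel_Q:
  assumes u: "continuous_on {x..} u" "bounded (u ` {x..})" and x: "0 \<le> x"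
    and c: "continuous_on {x..} c" "\<And>t. t \<ge> x \<Longrightarrow> norm (c t) \<le> B"
  shows "(\<lambda>t. c t *s (Q t *v u t)) absolutely_integrable_on {x..}"
proof -
  have "bounded (c ` {x..})" using c(2) by (auto simp: bounded_iff)
  then show ?thesis
    by (intro absolutely_integrable_bounded_bilinear[OF bounded_bilinear_vector_smult c(1)] absolutely_integrable_Q[OF u x]) auto
qed

end

text \<open>One column combination F(x,k) v at fixed \<open>k\<close>. Axis vectors \<open>v\<close>
  yield the entries of \<open>F\<close> for holomorphy; arbitrary \<open>v\<close> are needed for
  the lower bound on the adjoint.\<close>

locale jost_vector = integrable_potential Q for Q :: "real \<Rightarrow> complex^'n^'n" +
  fixes k :: complex and v :: "complex^'n" and f f' :: "real \<Rightarrow> complex^'n"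
  assumes k: "Im k > 0"
    and f: "\<And>x. x \<ge> 0 \<Longrightarrow> (f has_vector_derivative f' x) (at x within {0..})"
    and f': "\<And>x. x \<ge> 0 \<Longrightarrow> ((\<lambda>t. Q t *v f t - k\<^sup>2 *s f t) has_integral (f' x - f' 0)) {0..x}"
    and f_lim: "((\<lambda>x. exp (- \<i> * k * of_real x) *s f x) \<longlongrightarrow> v) at_top"
begin

definition m :: "real \<Rightarrow> complex^'n" where "m x = exp (- \<i> * k * of_real x) *s f x"

lemma k_nz: "k \<noteq> 0" using k by auto

lemma cont_f: "continuous_on {0..} f"
  using f by (auto simp: continuous_on_eq_continuous_within intro: has_vector_derivative_continuous)

lemma cont_f': "continuous_on {0..b} f'"
proof (cases "b \<ge> 0")
  case True
  have "continuous_on {0..b} (\<lambda>x. f' 0 + integral {0..x} (\<lambda>t. Q t *v f t - k\<^sup>2 *s f t))"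
    using f'[OF True] by (intro continuous_intros indefinite_integral_continuous_1) (auto simp: has_integral_iff)
  then show ?thesis
    by (rule continuous_on_eq) (use f' in \<open>auto simp: has_integral_iff\<close>)
qed auto

lemma f_integral: "x \<ge> 0 \<Longrightarrow> (f' has_integral (f x - f 0)) {0..x}"
  by (rule fundamental_theorem_of_calculus) (auto intro: has_vector_derivative_within_subset[OF f])

lemma abs_Qf: "(\<lambda>t. Q t *v f t) absolutely_integrable_on {0..b}"
  by (rule absolutely_integrable_bilinear_interval[OF bounded_bilinear.flip[OF bounded_bilinear_matrix_vector_mult]])
     (use continuous_on_subset[OF cont_f] set_integrable_subset[OF Q, of "{0..b}"] in auto)

lemma cont_m: "continuous_on {0..} m"
  unfolding m_def
  by (intro bounded_bilinear.continuous_on[OF bounded_bilinear_vector_smult] continuous_intros cont_f)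

lemma m_lim: "(m \<longlongrightarrow> v) at_top"
  using f_lim by (simp add: m_def[abs_def])

lemma bounded_m: "bounded (m ` {0..})"
  by (rule bounded_image_atLeast_if_tendsto[OF cont_m m_lim])

text \<open>Used with \<open>c = \<plusminus>\<i>k\<close>: the two first-order factors of \<open>f'' + k\<^sup>2 f\<close>.\<close>
lemma exponential_integral:
  assumes c: "c\<^sup>2 = - k\<^sup>2" and ab: "0 \<le> a" "a \<le> b"
  defines "E \<equiv> \<lambda>x. exp (- (c * of_real x)) *s (f' x + c *s f x)"
  shows "((\<lambda>t. exp (- (c * of_real t)) *s (Q t *v f t)) has_integral (E b - E a)) {a..b}"
proof (rule has_integral_subsegment[OF _ ab])
  fix x :: real assume x: "x \<ge> 0"
  let ?e = "\<lambda>t. exp (- (c * of_real t))"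
  let ?r = "\<lambda>t. (Q t *v f t - k\<^sup>2 *s f t) + c *s f' t"
  have cf: "continuous_on {0..x} f" by (rule continuous_on_subset[OF cont_f]) auto
  have ce: "((\<lambda>t. - c * ?e t) has_integral (?e y - ?e 0)) {0..y}" if "y \<in> {0..x}" for y
  proof (rule fundamental_theorem_of_calculus)
    show "(?e has_vector_derivative (- c * ?e t)) (at t within {0..y})" for t
      by (rule has_vector_derivative_real_field[where f = "\<lambda>z. exp (- (c * z))"]) (auto intro!: derivative_eq_intros)
  qed (use that in auto)
  have ae: "(\<lambda>t. - c * ?e t) absolutely_integrable_on {0..x}"
    by (intro absolutely_integrable_continuous_real continuous_intros)
  have ar: "?r absolutely_integrable_on {0..x}"
    by (intro set_integral_add(1) set_integral_diff(1) abs_Qf absolutely_integrable_continuous_real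
        bounded_bilinear.continuous_on[OF bounded_bilinear_vector_smult] continuous_on_const cf cont_f')
  have cr: "(?r has_integral ((f' y + c *s f y) - (f' 0 + c *s f 0))) {0..y}" if "y \<in> {0..x}" for y
  proof -
    have "((\<lambda>t. c *s f' t) has_integral (c *s (f y - f 0))) {0..y}"
      using has_integral_linear[OF f_integral bounded_bilinear.bounded_linear_right[OF bounded_bilinear_vector_smult, of c], of y] that
      by (simp add: o_def)
    then have "(?r has_integral ((f' y - f' 0) + c *s (f y - f 0))) {0..y}"
      using that by (intro has_integral_add f') auto
    then show ?thesis by (simp add: algebra_simps vector_ssub_ldistrib)
  qed
  have "((\<lambda>t. (- c * ?e t) *s (f' t + c *s f t) + ?e t *s ?r t) has_integral (E x - E 0)) {0..x}"
    unfolding E_def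
    by (rule product_rule_indefinite_integrals[OF bounded_bilinear_vector_smult x ae ar ce cr])
  \<comment> \<open>The terms in \<open>f'\<close> cancel, and those in \<open>f\<close> add up to
    -(c^2 + k^2) f = 0.\<close>
  also have "(\<lambda>t. (- c * ?e t) *s (f' t + c *s f t) + ?e t *s ?r t) = (\<lambda>t. ?e t *s (Q t *v f t))"
  proof
    fix t
    have "- (c * c) = k * k" using c by (simp add: power2_eq_square)
    then have alg: "- c * e * (d + c * g) + e * ((w - k * k * g) + c * d) = e * w" for e d g w
      by algebra
    show "(- c * ?e t) *s (f' t + c *s f t) + ?e t *s ?r t = ?e t *s (Q t *v f t)"
      by (simp only: vec_eq_iff vector_add_component vector_minus_component vector_smult_component power2_eq_square alg simp_thms)
  qed
  finally show "((\<lambda>t. ?e t *s (Q t *v f t)) has_integral (E x - E 0)) {0..x}" .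
qed

definition Qm :: "real \<Rightarrow> complex^'n" where "Qm t = Q t *v m t"

lemma abs_Qm: "x \<ge> 0 \<Longrightarrow> Qm absolutely_integrable_on {x..}"
  unfolding Qm_def
  by (rule absolutely_integrable_Q) (auto intro: continuous_on_subset[OF cont_m] bounded_subset[OF bounded_m])

lemma abs_exp_Qm:
  assumes "x \<ge> 0" shows "(\<lambda>t. exp (2 * \<i> * k * of_real (t - x)) *s Qm t) absolutely_integrable_on {x..}"
proof -
  have "bounded ((\<lambda>t. exp (2 * \<i> * k * of_real (t - x))) ` {x..})"
    unfolding bounded_iff using norm_exp_upper_half_le_1[of k "_ - x"] k
    by (auto intro!: exI[of _ 1] simp del: of_real_diff)
  then show ?thesis
    by (intro absolutely_integrable_bounded_bilinear[OF bounded_bilinear_vector_smult] abs_Qm[OF assms] continuous_intros) auto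
qed

text \<open>In terms of m, \<open>Pf\<close> is m' + 2ik m and \<open>Rf\<close> below is m'. The
  derivatives of \<open>Pf\<close> and of exp(2ikx) \<open>Rf\<close> are Q m and exp(2ikx) Q m, so
  both can be integrated directly.\<close>

definition Pf :: "real \<Rightarrow> complex^'n" where
  "Pf x = exp (- \<i> * k * of_real x) *s (f' x + (\<i> * k) *s f x)"
definition Rf :: "real \<Rightarrow> complex^'n" where
  "Rf x = exp (- \<i> * k * of_real x) *s (f' x - (\<i> * k) *s f x)"

lemma Pf_minus_Rf: "Pf x - Rf x = (2 * \<i> * k) *s m x"
  by (simp add: Pf_def Rf_def m_def vec_eq_iff algebra_simps)

lemma Pf_segment:
  assumes "0 \<le> a" "a \<le> b" shows "(Qm has_integral (Pf b - Pf a)) {a..b}"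
proof -
  have "(\<i> * k)\<^sup>2 = - k\<^sup>2" by (simp add: power_mult_distrib)
  from exponential_integral[OF this assms] show ?thesis
    by (simp add: Pf_def Qm_def[abs_def] m_def matrix_vector_mult_smult)
qed

lemma Rf_segment:
  assumes "0 \<le> a" "a \<le> b"
  shows "((\<lambda>t. exp (2 * \<i> * k * of_real t) *s Qm t) has_integral
    (exp (2 * \<i> * k * of_real b) *s Rf b - exp (2 * \<i> * k * of_real a) *s Rf a)) {a..b}"
proof -
  have e: "exp (2 * \<i> * k * of_real t) * exp (- \<i> * k * of_real t) = exp (- (- \<i> * k * of_real t))" for t
    by (simp add: algebra_simps flip: exp_add)
  have c: "(- \<i> * k)\<^sup>2 = - k\<^sup>2" by (simp add: power_mult_distrib)
  have 1: "exp (2 * \<i> * k * of_real t) *s Qm t = exp (- (- \<i> * k * of_real t)) *s (Q t *v f t)" for t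
    unfolding Qm_def m_def matrix_vector_mult_smult vector_smult_assoc e ..
  have 2: "exp (2 * \<i> * k * of_real t) *s Rf t = exp (- (- \<i> * k * of_real t)) *s (f' t + (- \<i> * k) *s f t)" for t
    unfolding Rf_def vector_smult_assoc e by (simp add: vec_eq_iff)
  show ?thesis
    unfolding 1 2 by (rule exponential_integral[OF c assms])
qed

lemma exp_decay: "((\<lambda>y. exp (2 * \<i> * k * of_real y)) \<longlongrightarrow> 0) at_top"
proof (rule tendsto_norm_zero_cancel)
  have "((\<lambda>y. exp (- (2 * Im k) * y)) \<longlongrightarrow> 0) at_top"
    using k by real_asymp
  then show "((\<lambda>y. norm (exp (2 * \<i> * k * of_real y))) \<longlongrightarrow> 0) at_top"
    by (simp add: norm_exp_eq_Re)
qed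

text \<open>Both integrated equations converge at infinity because Q m is integrable; the point is
  to identify the limits. Since \<open>Rf\<close> = \<open>Pf\<close> - 2ik m is bounded and
  exp(2ikx) decays, the limit of exp(2ikx) \<open>Rf\<close> is zero. The resulting formula sends
  \<open>Rf\<close> itself to zero, and hence \<open>Pf\<close> to 2ik v.\<close>

lemma Pf_Rf_formulas:
  assumes x: "x \<ge> 0"
  shows "Pf x = (2 * \<i> * k) *s v - integral {x..} Qm"
    and "Rf x = - integral {x..} (\<lambda>t. exp (2 * \<i> * k * of_real (t - x)) *s Qm t)"
proof -
  let ?e = "\<lambda>t. exp (2 * \<i> * k * of_real t)"
  have aE: "(\<lambda>t. ?e t *s Qm t) absolutely_integrable_on {0..}" using abs_exp_Qm[of 0] by simp
  \<comment> \<open>\<open>p\<close> is the limit of \<open>Pf\<close> at infinity; \<open>s\<close>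
    below is that of exp(2ikx) \<open>Rf\<close>.\<close>
  define p where "p = Pf 0 + integral {0..} Qm"
  have P: "Pf y = p - integral {y..} Qm" if "y \<ge> 0" for y
    using Pf_segment[OF order_refl that] integral_atLeast_split[OF abs_Qm[of 0] order_refl that]
    by (auto simp: p_def has_integral_iff algebra_simps)
  have Plim: "(Pf \<longlongrightarrow> p) at_top"
  proof (rule Lim_transform_eventually)
    show "((\<lambda>y. p - integral {y..} Qm) \<longlongrightarrow> p) at_top"
      using integral_atLeast_tendsto_0[OF abs_Qm[of 0]] by (auto intro!: tendsto_eq_intros)
    show "eventually (\<lambda>y. p - integral {y..} Qm = Pf y) at_top"
      using eventually_ge_at_top[of 0] by eventually_elim (simp add: P)
  qed
  define s where "s = ?e 0 *s Rf 0 + integral {0..} (\<lambda>t. ?e t *s Qm t)"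
  have S: "?e y *s Rf y = s - integral {y..} (\<lambda>t. ?e t *s Qm t)" if "y \<ge> 0" for y
    using Rf_segment[OF order_refl that] integral_atLeast_split[OF aE order_refl that]
    by (auto simp: s_def has_integral_iff algebra_simps)
  have "((\<lambda>y. ?e y *s (Pf y - (2 * \<i> * k) *s m y)) \<longlongrightarrow> 0 *s (p - (2 * \<i> * k) *s v)) at_top"
    by (intro bounded_bilinear.tendsto[OF bounded_bilinear_vector_smult] exp_decay tendsto_diff Plim tendsto_const m_lim)
  moreover have "Pf y - (2 * \<i> * k) *s m y = Rf y" for y using Pf_minus_Rf[of y] by (simp add: algebra_simps)
  ultimately have "((\<lambda>y. ?e y *s Rf y) \<longlongrightarrow> 0) at_top" by simp
  then have "((\<lambda>y. ?e y *s Rf y + integral {y..} (\<lambda>t. ?e t *s Qm t)) \<longlongrightarrow> 0 + 0) at_top"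
    by (intro tendsto_add integral_atLeast_tendsto_0[OF aE])
  moreover have "eventually (\<lambda>y. ?e y *s Rf y + integral {y..} (\<lambda>t. ?e t *s Qm t) = s) at_top"
    using eventually_ge_at_top[of 0] by eventually_elim (simp add: S)
  ultimately have "((\<lambda>y::real. s) \<longlongrightarrow> 0 + 0) at_top" by (rule Lim_transform_eventually)
  then have s0: "s = 0" by (simp add: tendsto_const_iff)
  have R: "Rf y = - integral {y..} (\<lambda>t. exp (2 * \<i> * k * of_real (t - y)) *s Qm t)" if y: "y \<ge> 0" for y
  proof -
    have "Rf y = ?e (- y) *s (?e y *s Rf y)" by (simp add: vector_smult_assoc flip: exp_add)
    also have "\<dots> = - (?e (- y) *s integral {y..} (\<lambda>t. ?e t *s Qm t))"
      unfolding S[OF y] s0 by (simp add: vec_eq_iff)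
    also have "?e (- y) *s integral {y..} (\<lambda>t. ?e t *s Qm t) = integral {y..} (\<lambda>t. ?e (- y) *s (?e t *s Qm t))"
      by (rule integral_vector_smult[symmetric], rule integrable_on_subset_of_absolutely_integrable[OF aE]) (use y in auto)
    also have "(\<lambda>t. ?e (- y) *s (?e t *s Qm t)) = (\<lambda>t. exp (2 * \<i> * k * of_real (t - y)) *s Qm t)"
      by (rule ext) (simp add: vector_smult_assoc algebra_simps flip: exp_add)
    finally show ?thesis .
  qed
  then show "Rf x = - integral {x..} (\<lambda>t. exp (2 * \<i> * k * of_real (t - x)) *s Qm t)" using x .
  have "(Rf \<longlongrightarrow> 0) at_top"
  proof (rule Lim_null_comparison)
    have an: "(\<lambda>t. norm (Qm t)) absolutely_integrable_on {0..}" by (rule set_integrable_norm[OF abs_Qm]) simp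
    then show "((\<lambda>y. integral {y..} (\<lambda>t. norm (Qm t))) \<longlongrightarrow> 0) at_top" by (rule integral_atLeast_tendsto_0)
    show "eventually (\<lambda>y. norm (Rf y) \<le> integral {y..} (\<lambda>t. norm (Qm t))) at_top"
      using eventually_ge_at_top[of 0]
    proof eventually_elim
      case (elim y)
      have "norm (integral {y..} (\<lambda>t. exp (2 * \<i> * k * of_real (t - y)) *s Qm t)) \<le> integral {y..} (\<lambda>t. norm (Qm t))"
      proof (rule integral_norm_bound_integral)
        show "(\<lambda>t. exp (2 * \<i> * k * of_real (t - y)) *s Qm t) integrable_on {y..}"
          by (rule set_lebesgue_integral_eq_integral(1)[OF abs_exp_Qm[OF elim]])
        show "(\<lambda>t. norm (Qm t)) integrable_on {y..}"
          by (rule integrable_on_subset_of_absolutely_integrable[OF an]) (use elim in auto)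
        show "norm (exp (2 * \<i> * k * of_real (t - y)) *s Qm t) \<le> norm (Qm t)" if "t \<in> {y..}" for t
          unfolding norm_vector_smult
          by (rule mult_left_le_one_le) (use norm_exp_upper_half_le_1[of k "t - y"] that k in auto)
      qed
      then show ?case using R[OF elim] by simp
    qed
  qed
  then have "((\<lambda>y. Rf y + (2 * \<i> * k) *s m y) \<longlongrightarrow> 0 + (2 * \<i> * k) *s v) at_top"
    by (intro tendsto_add bounded_bilinear.tendsto[OF bounded_bilinear_vector_smult] m_lim tendsto_const)
  moreover have "Rf y + (2 * \<i> * k) *s m y = Pf y" for y using Pf_minus_Rf[of y] by (simp add: algebra_simps)
  ultimately have "(Pf \<longlongrightarrow> (2 * \<i> * k) *s v) at_top" by simp
  with Plim have "p = (2 * \<i> * k) *s v" by (rule tendsto_unique[rotated]) simp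
  with P[OF x] show "Pf x = (2 * \<i> * k) *s v - integral {x..} Qm" by simp
qed

text \<open>m is (Pf - Rf)/(2ik) and exp(-ikx) f' is (Pf + Rf)/2; the two kernels arise from
  combining the integrals for \<open>Pf\<close> and \<open>Rf\<close> accordingly.\<close>

lemma kernel_integrals:
  assumes x: "x \<ge> 0"
  shows "m x = v + integral {x..} (\<lambda>t. jost_kernel k (t - x) *s Qm t)"
    and "exp (- \<i> * k * of_real x) *s f' x = (\<i> * k) *s v + integral {x..} (\<lambda>t. jost_kernel_deriv k (t - x) *s Qm t)"
proof -
  let ?E = "\<lambda>t. exp (2 * \<i> * k * of_real (t - x)) *s Qm t"
  have i: "Qm integrable_on {x..}" "?E integrable_on {x..}"
    using abs_Qm[OF x] abs_exp_Qm[OF x] by (auto intro: set_lebesgue_integral_eq_integral(1))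
  \<comment> \<open>The value d = 1 produces \<open>jost_kernel\<close>, and d = -1 produces
    \<open>jost_kernel_deriv\<close>.\<close>
  have I: "integral {x..} (\<lambda>t. c *s (?E t - d *s Qm t)) = c *s (integral {x..} ?E - d *s integral {x..} Qm)" for c d
  proof -
    have j: "(\<lambda>t. d *s Qm t) integrable_on {x..}"
      using integrable_linear[OF i(1) bounded_bilinear.bounded_linear_right[OF bounded_bilinear_vector_smult, of d]] by (simp add: o_def)
    show ?thesis
      unfolding integral_vector_smult[OF integrable_diff[OF i(2) j]]
        Henstock_Kurzweil_Integration.integral_diff[OF i(2) j] integral_vector_smult[OF i(1)] ..
  qed
  have "(\<lambda>t. jost_kernel k (t - x) *s Qm t) = (\<lambda>t. (1 / (2 * \<i> * k)) *s (?E t - 1 *s Qm t))"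
    using k_nz by (auto simp: fun_eq_iff vec_eq_iff jost_kernel_def field_simps)
  then have "integral {x..} (\<lambda>t. jost_kernel k (t - x) *s Qm t) = (1 / (2 * \<i> * k)) *s (integral {x..} ?E - 1 *s integral {x..} Qm)"
    by (simp only: I)
  also have "\<dots> = (1 / (2 * \<i> * k)) *s (- Rf x + (Pf x - (2 * \<i> * k) *s v))"
    unfolding Pf_Rf_formulas[OF x] by simp
  also have "\<dots> = (1 / (2 * \<i> * k)) *s ((2 * \<i> * k) *s m x - (2 * \<i> * k) *s v)"
    unfolding Pf_minus_Rf[of x, symmetric] by (simp add: algebra_simps)
  also have "\<dots> = m x - v"
    using k_nz by (simp add: vec_eq_iff flip: right_diff_distrib)
  finally have *: "integral {x..} (\<lambda>t. jost_kernel k (t - x) *s Qm t) = m x - v" .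
  show "m x = v + integral {x..} (\<lambda>t. jost_kernel k (t - x) *s Qm t)"
    unfolding * by (simp only: add_diff_eq add_diff_cancel_left')
  have "(\<lambda>t. jost_kernel_deriv k (t - x) *s Qm t) = (\<lambda>t. (- 1 / 2) *s (?E t - (- 1) *s Qm t))"
    by (auto simp: fun_eq_iff vec_eq_iff jost_kernel_deriv_def field_simps)
  then have "integral {x..} (\<lambda>t. jost_kernel_deriv k (t - x) *s Qm t) = (- 1 / 2) *s (integral {x..} ?E - (- 1) *s integral {x..} Qm)"
    by (simp only: I)
  also have "\<dots> = (- 1 / 2) *s (- Rf x - (- 1) *s ((2 * \<i> * k) *s v - Pf x))"
    unfolding Pf_Rf_formulas[OF x] by simp
  also have "\<dots> = exp (- \<i> * k * of_real x) *s f' x - (\<i> * k) *s v"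
  proof -
    have alg: "(- 1 / 2) * (- (e * (d - \<i> * k * g)) - (- 1) * ((2 * \<i> * k) * w - e * (d + \<i> * k * g))) = e * d - \<i> * k * w" for e d g w
      by (simp add: field_simps)
    show ?thesis
      unfolding Pf_def Rf_def
      by (simp only: vec_eq_iff vector_add_component vector_minus_component vector_uminus_component vector_smult_component alg simp_thms)
  qed
  finally have *: "integral {x..} (\<lambda>t. jost_kernel_deriv k (t - x) *s Qm t) = exp (- \<i> * k * of_real x) *s f' x - (\<i> * k) *s v" .
  show "exp (- \<i> * k * of_real x) *s f' x = (\<i> * k) *s v + integral {x..} (\<lambda>t. jost_kernel_deriv k (t - x) *s Qm t)"
    unfolding * by (simp only: add_diff_eq add_diff_cancel_left')
qed

end

section \<open>The Neumann series\<close>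

lemma holomorphic_on_if_locally:
  assumes "\<And>z. z \<in> S \<Longrightarrow> \<exists>r>0. f holomorphic_on ball z r"
  shows "f holomorphic_on S"
proof (rule holomorphic_onI)
  fix z assume "z \<in> S"
  then obtain r where "r > 0" "f holomorphic_on ball z r" using assms by blast
  then show "f field_differentiable at z within S"
    by (auto intro!: field_differentiable_at_within[OF holomorphic_on_imp_differentiable_at[of f "ball z r"]])
qed

text \<open>The lower bound on |k| makes the kernel bound 1/|k| uniform on the disc.\<close>

lemma ball_upper_half_plane:
  assumes "Im k0 > 0" "k \<in> ball k0 (Im k0 / 2)"
  shows "Im k > Im k0 / 2" "norm k \<ge> Im k0 / 2" "k \<noteq> 0"
proof -
  have "\<bar>Im (k0 - k)\<bar> < Im k0 / 2"
    using abs_Im_le_cmod[of "k0 - k"] assms by (simp add: dist_norm)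
  then show 1: "Im k > Im k0 / 2" by (simp add: abs_if split: if_splits)
  then show "norm k \<ge> Im k0 / 2" using abs_Im_le_cmod[of k] by linarith
  then show "k \<noteq> 0" using assms(1) by auto
qed

text \<open>Replacing |k| by a lower bound \<open>r\<close> and the tail by its value at 0 turns
  bounds on the iterates into terms of an exponential series free of \<open>k\<close> and
  \<open>x\<close>. The scaled division \<open>/\<^sub>R\<close> is the form used by
  \<open>exp_converges\<close>.\<close>

lemma neumann_majorant:
  fixes V K r a b :: real
  assumes "0 < r" "r \<le> K" "0 \<le> a" "a \<le> b" "0 \<le> V"
  shows "V / (K ^ n * fact n) * a ^ n \<le> V * ((b / r) ^ n /\<^sub>R fact n)"
proof -
  have "(a / K) ^ n \<le> (b / r) ^ n"
    by (rule power_mono, rule frac_le) (use assms in auto)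
  then have "V * ((a / K) ^ n / fact n) \<le> V * ((b / r) ^ n / fact n)"
    by (rule mult_left_mono[OF divide_right_mono]) (use assms in auto)
  then show ?thesis by (simp add: power_divide power_mult_distrib power_inverse divide_inverse mult_ac)
qed

context integrable_potential
begin

definition tail :: "real \<Rightarrow> real" where "tail x = integral {x..} (\<lambda>t. norm (Q t))"

lemma abs_norm_Q: "0 \<le> x \<Longrightarrow> (\<lambda>t. norm (Q t)) absolutely_integrable_on {x..}"
  by (rule set_integrable_norm[OF set_integrable_subset[OF Q]]) auto

lemma integrable_norm_Q: "0 \<le> x \<Longrightarrow> (\<lambda>t. norm (Q t)) integrable_on {x..}"
  using abs_norm_Q by (rule set_lebesgue_integral_eq_integral(1))

lemma tail_nonneg: "0 \<le> x \<Longrightarrow> 0 \<le> tail x"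
  unfolding tail_def by (rule integral_nonneg[OF integrable_norm_Q]) auto

lemma tail_le: "0 \<le> x \<Longrightarrow> tail x \<le> tail 0"
  unfolding tail_def by (rule integral_subset_le[OF _ integrable_norm_Q integrable_norm_Q]) auto

lemma tail_tendsto_0: "(tail \<longlongrightarrow> 0) at_top"
  using integral_atLeast_tendsto_0[OF abs_norm_Q[of 0]] by (simp add: tail_def[abs_def])

definition volterra :: "complex \<Rightarrow> (real \<Rightarrow> complex^'n) \<Rightarrow> real \<Rightarrow> complex^'n" where
  "volterra k u x = integral {x..} (\<lambda>t. jost_kernel k (t - x) *s (Q t *v u t))"

text \<open>Kernel and power are kept general: the estimate serves the iteration, where each step
  raises \<open>n\<close>, and also both kernels with n = 0, where the hypothesis on
  \<open>u\<close> is plain boundedness.\<close>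

lemma kernel_integral_bound:
  assumes x: "0 \<le> x" and u: "continuous_on {0..} u" "\<And>t. t \<ge> 0 \<Longrightarrow> norm (u t) \<le> C * tail t ^ n"
    and c: "continuous_on {x..} c" "\<And>t. t \<ge> x \<Longrightarrow> norm (c t) \<le> B"
  shows "(\<lambda>t. c t *s (Q t *v u t)) absolutely_integrable_on {x..}"
    and "norm (integral {x..} (\<lambda>t. c t *s (Q t *v u t))) \<le> B * C * (tail x ^ Suc n / real (Suc n))"
proof -
  \<comment> \<open>\<open>C\<close> is not assumed non-negative, hence the absolute value.\<close>
  have "norm (u t) \<le> \<bar>C\<bar> * tail 0 ^ n" if "t \<ge> x" for t
  proof -
    have "norm (u t) \<le> C * tail t ^ n" using u(2) that x by simp
    also have "\<dots> \<le> \<bar>C\<bar> * tail t ^ n" using that x tail_nonneg[of t] by (intro mult_right_mono) auto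
    also have "\<dots> \<le> \<bar>C\<bar> * tail 0 ^ n"
      using that x tail_nonneg[of t] tail_le[of t] by (intro mult_left_mono power_mono) auto
    finally show ?thesis .
  qed
  then have bu: "bounded (u ` {x..})" by (auto simp: bounded_iff)
  have cu: "continuous_on {x..} u" by (rule continuous_on_subset[OF u(1)]) (use x in auto)
  show ab: "(\<lambda>t. c t *s (Q t *v u t)) absolutely_integrable_on {x..}"
    by (rule absolutely_integrable_kernel_Q[OF cu bu x c])
  have hi: "((\<lambda>t. norm (Q t) * tail t ^ n) has_integral (tail x ^ Suc n / real (Suc n))) {x..}"
    unfolding tail_def by (rule integral_times_tail_power(1)[OF abs_norm_Q[OF order_refl] x])
  have "norm (integral {x..} (\<lambda>t. c t *s (Q t *v u t))) \<le> integral {x..} (\<lambda>t. (B * C) * (norm (Q t) * tail t ^ n))"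
  proof (rule integral_norm_bound_integral)
    show "(\<lambda>t. c t *s (Q t *v u t)) integrable_on {x..}" by (rule set_lebesgue_integral_eq_integral(1)[OF ab])
    show "(\<lambda>t. (B * C) * (norm (Q t) * tail t ^ n)) integrable_on {x..}"
      by (rule integrable_on_mult_right) (use hi in \<open>auto simp: integrable_on_def\<close>)
    fix t assume t: "t \<in> {x..}"
    have "norm (c t *s (Q t *v u t)) = norm (c t) * norm (Q t *v u t)" by (rule norm_vector_smult)
    also have "\<dots> \<le> B * (norm (Q t) * (C * tail t ^ n))"
      using c(2)[of t] t x order_trans[OF norm_matrix_vector_mult_le mult_left_mono[OF u(2)[of t]], of "Q t"]
      by (intro mult_mono) (auto intro: order_trans[OF norm_ge_zero])
    finally show "norm (c t *s (Q t *v u t)) \<le> B * C * (norm (Q t) * tail t ^ n)" by (simp only: mult_ac)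
  qed
  also have "\<dots> = B * C * (tail x ^ Suc n / real (Suc n))"
    by (rule integral_unique[OF has_integral_mult_right[OF hi]])
  finally show "norm (integral {x..} (\<lambda>t. c t *s (Q t *v u t))) \<le> B * C * (tail x ^ Suc n / real (Suc n))" .
qed

lemma volterra_bound:
  assumes k: "Im k > 0" and x: "0 \<le> x"
    and u: "continuous_on {0..} u" "\<And>t. t \<ge> 0 \<Longrightarrow> norm (u t) \<le> C * tail t ^ n"
  shows "(\<lambda>t. jost_kernel k (t - x) *s (Q t *v u t)) absolutely_integrable_on {x..}"
    and "norm (volterra k u x) \<le> 1 / norm k * C * (tail x ^ Suc n / real (Suc n))"
  unfolding volterra_def
  by (rule kernel_integral_bound[OF x u, where B = "1 / norm k"];
      use k norm_jost_kernel_le(1)[of k] in \<open>auto intro!: continuous_intros\<close>)+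

text \<open>x occurs in the kernel as well as in the limit of integration. Splitting exp(2ik(t-x))
  into exp(-2ikx) exp(2ikt) moves it in front of the integral and leaves tails of fixed integrable
  functions.\<close>

lemma continuous_on_volterra:
  assumes k: "Im k > 0" and u: "continuous_on {0..} u" "bounded (u ` {0..})"
  shows "continuous_on {0..} (volterra k u)"
proof -
  let ?e = "\<lambda>t. exp (2 * \<i> * k * of_real t)"
  have aE: "(\<lambda>t. ?e t *s (Q t *v u t)) absolutely_integrable_on {0..}"
    by (rule absolutely_integrable_kernel_Q[OF u order_refl, where B = 1])
       (use norm_exp_upper_half_le_1[of k] k in \<open>auto intro!: continuous_intros\<close>)
  have aQ: "(\<lambda>t. Q t *v u t) absolutely_integrable_on {0..}"
    by (rule absolutely_integrable_Q[OF u order_refl])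
  have "continuous_on {0..} (\<lambda>x. (1 / (2 * \<i> * k)) *s (?e (- x) *s integral {x..} (\<lambda>t. ?e t *s (Q t *v u t)) - integral {x..} (\<lambda>t. Q t *v u t)))"
    by (intro bounded_bilinear.continuous_on[OF bounded_bilinear_vector_smult] continuous_intros
         continuous_on_integral_atLeast aE aQ)
  then show ?thesis
  proof (rule continuous_on_eq)
    fix x :: real assume x: "x \<in> {0..}"
    have i: "(\<lambda>t. ?e t *s (Q t *v u t)) integrable_on {x..}" "(\<lambda>t. Q t *v u t) integrable_on {x..}"
      by (rule integrable_on_subset_of_absolutely_integrable[OF aE] integrable_on_subset_of_absolutely_integrable[OF aQ]; use x in auto)+
    have i': "(\<lambda>t. ?e (- x) *s (?e t *s (Q t *v u t))) integrable_on {x..}"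
      using integrable_linear[OF i(1) bounded_bilinear.bounded_linear_right[OF bounded_bilinear_vector_smult, of "?e (- x)"]]
      by (simp add: o_def)
    have kn: "jost_kernel k (t - x) *s w = (1 / (2 * \<i> * k)) *s (?e (- x) *s (?e t *s w) - w)" for t and w :: "complex^'n"
    proof -
      have e: "exp (2 * \<i> * k * of_real (t - x)) = ?e (- x) * ?e t"
        by (simp add: algebra_simps flip: exp_add)
      have alg: "(a * b - 1) / c * z = 1 / c * (a * (b * z) - z)" for a b c z :: complex
        by (simp add: algebra_simps diff_divide_distrib)
      show ?thesis unfolding jost_kernel_def e
        by (simp only: vec_eq_iff vector_minus_component vector_smult_component alg simp_thms)
    qed
    show "(1 / (2 * \<i> * k)) *s (?e (- x) *s integral {x..} (\<lambda>t. ?e t *s (Q t *v u t)) - integral {x..} (\<lambda>t. Q t *v u t)) = volterra k u x"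
      unfolding volterra_def kn integral_vector_smult[OF integrable_diff[OF i' i(2)]]
        Henstock_Kurzweil_Integration.integral_diff[OF i' i(2)] integral_vector_smult[OF i(1)] ..
  qed
qed

text \<open>The decomposition of \<open>s\<close> is required on t >= 0 only, the range on which the
  Volterra equation for m holds.\<close>

lemma volterra_add:
  assumes k: "Im k > 0" and x: "0 \<le> x"
    and u: "continuous_on {0..} u" "bounded (u ` {0..})"
    and w: "continuous_on {0..} w" "bounded (w ` {0..})"
    and s: "\<And>t. t \<ge> 0 \<Longrightarrow> s t = u t + w t"
  shows "volterra k s x = volterra k u x + volterra k w x"
proof -
  have i: "(\<lambda>t. jost_kernel k (t - x) *s (Q t *v y t)) integrable_on {x..}"
    if "continuous_on {0..} y" "bounded (y ` {0..})" for y
    by (rule set_lebesgue_integral_eq_integral(1), rule absolutely_integrable_kernel_Q[where B = "1 / norm k"])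
       (use that x k norm_jost_kernel_le(1)[of k] in \<open>auto intro!: continuous_intros intro: continuous_on_subset bounded_subset\<close>)
  have "volterra k s x = integral {x..} (\<lambda>t. jost_kernel k (t - x) *s (Q t *v u t) + jost_kernel k (t - x) *s (Q t *v w t))"
    unfolding volterra_def
    by (rule integral_cong) (use x in \<open>simp add: s matrix_vector_right_distrib vector_add_ldistrib\<close>)
  also have "\<dots> = volterra k u x + volterra k w x"
    unfolding volterra_def by (rule Henstock_Kurzweil_Integration.integral_add[OF i[OF u] i[OF w]])
  finally show ?thesis .
qed

lemma bounded_if_tail_bound:
  assumes "\<And>t. t \<ge> 0 \<Longrightarrow> norm (u t) \<le> C * tail t ^ n" "C \<ge> 0"
  shows "bounded (u ` {0..})"
proof -
  have "norm (u t) \<le> C * tail 0 ^ n" if "t \<ge> 0" for t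
    by (rule order_trans[OF assms(1)[OF that]])
       (use that assms(2) tail_nonneg tail_le in \<open>auto intro!: mult_left_mono power_mono\<close>)
  then show ?thesis by (auto simp: bounded_iff)
qed

text \<open>Each application contributes 1/|k| from the kernel and 1/(n+1) from integrating the n-th
  tail power.\<close>

lemma volterra_iterate:
  assumes k: "Im k > 0" and u: "continuous_on {0..} u" "\<And>t. t \<ge> 0 \<Longrightarrow> norm (u t) \<le> C" and C: "C \<ge> 0"
  shows "continuous_on {0..} ((volterra k ^^ n) u)"
    and "\<And>t. t \<ge> 0 \<Longrightarrow> norm ((volterra k ^^ n) u t) \<le> C / (norm k ^ n * fact n) * tail t ^ n"
    and "bounded ((volterra k ^^ n) u ` {0..})"
proof -
  have *: "continuous_on {0..} ((volterra k ^^ n) u) \<and> (\<forall>t\<ge>0. norm ((volterra k ^^ n) u t) \<le> C / (norm k ^ n * fact n) * tail t ^ n)" for n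
  proof (induction n)
    case 0
    then show ?case using u by simp
  next
    case (Suc n)
    then have c: "continuous_on {0..} ((volterra k ^^ n) u)"
      and b: "\<And>t. t \<ge> 0 \<Longrightarrow> norm ((volterra k ^^ n) u t) \<le> C / (norm k ^ n * fact n) * tail t ^ n" by auto
    have "C / (norm k ^ n * fact n) \<ge> 0" using C by simp
    from continuous_on_volterra[OF k c bounded_if_tail_bound[OF b this]]
    have 1: "continuous_on {0..} ((volterra k ^^ Suc n) u)" by simp
    have "norm ((volterra k ^^ Suc n) u t) \<le> C / (norm k ^ Suc n * fact (Suc n)) * tail t ^ Suc n" if "t \<ge> 0" for t
    proof -
      have "norm ((volterra k ^^ Suc n) u t) \<le> 1 / norm k * (C / (norm k ^ n * fact n)) * (tail t ^ Suc n / real (Suc n))"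
        using volterra_bound(2)[OF k that c b] by simp
      also have "\<dots> = C / (norm k ^ Suc n * fact (Suc n)) * tail t ^ Suc n"
        by (simp add: fact_Suc mult_ac)
      finally show ?thesis .
    qed
    with 1 show ?case by blast
  qed
  show "continuous_on {0..} ((volterra k ^^ n) u)" using * by blast
  show b: "norm ((volterra k ^^ n) u t) \<le> C / (norm k ^ n * fact n) * tail t ^ n" if "t \<ge> 0" for t using * that by blast
  show "bounded ((volterra k ^^ n) u ` {0..})"
    by (rule bounded_if_tail_bound[OF b]) (use C in auto)
qed

section \<open>Holomorphy of the iterates in the spectral parameter\<close>

lemma holomorphic_on_kernel_integral:
  fixes \<kappa> :: "complex \<Rightarrow> real \<Rightarrow> complex" and u :: "complex \<Rightarrow> real \<Rightarrow> complex^'n"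
  assumes x: "0 \<le> x"
    and c: "\<And>k. k \<in> ball k0 r \<Longrightarrow> continuous_on {x..} (\<lambda>t. \<kappa> k (t - x))"
    and ch: "\<And>s. s \<ge> 0 \<Longrightarrow> (\<lambda>k. \<kappa> k s) holomorphic_on ball k0 r"
    and cb: "\<And>k s. \<lbrakk>k \<in> ball k0 r; s \<ge> 0\<rbrakk> \<Longrightarrow> norm (\<kappa> k s) \<le> B"
    and u: "\<And>k. k \<in> ball k0 r \<Longrightarrow> continuous_on {0..} (u k)"
    and uh: "\<And>t j. t \<ge> 0 \<Longrightarrow> (\<lambda>k. u k t $ j) holomorphic_on ball k0 r"
    and ub: "\<And>k t. \<lbrakk>k \<in> ball k0 r; t \<ge> 0\<rbrakk> \<Longrightarrow> norm (u k t) \<le> C"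
  shows "(\<lambda>k. integral {x..} (\<lambda>t. \<kappa> k (t - x) *s (Q t *v u k t)) $ i) holomorphic_on ball k0 r"
proof -
  let ?h = "\<lambda>k t. \<kappa> k (t - x) *s (Q t *v u k t)"
  have int: "?h k integrable_on {x..}" if k: "k \<in> ball k0 r" for k
    by (rule set_lebesgue_integral_eq_integral(1), rule kernel_integral_bound(1)[OF x u[OF k], of C 0, OF _ c[OF k], of B])
       (use ub[OF k] cb[OF k] in auto)
  have "(\<lambda>k. integral {x..} (\<lambda>t. ?h k t $ i)) holomorphic_on ball k0 r"
  proof (rule holomorphic_on_integral_parameter)
    show "(\<lambda>t. ?h k t $ i) integrable_on {x..}" if "k \<in> ball k0 r" for k
      using integrable_linear[OF int[OF that] bounded_linear_vec_nth[of i]] by (simp add: o_def)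
    show "(\<lambda>k. ?h k t $ i) holomorphic_on ball k0 r" if "t \<in> {x..}" for t
      using that x unfolding vector_smult_component
      by (auto simp: matrix_vector_mult_def intro!: holomorphic_intros ch uh)
    show "(\<lambda>t. B * C * norm (Q t)) integrable_on {x..}"
      by (rule integrable_on_mult_right[OF integrable_norm_Q[OF x]])
    fix t k assume t: "t \<in> {x..}" and k: "k \<in> ball k0 r"
    have "norm (?h k t $ i) \<le> norm (?h k t)" by (rule Finite_Cartesian_Product.norm_nth_le)
    also have "\<dots> = norm (\<kappa> k (t - x)) * norm (Q t *v u k t)" by (rule norm_vector_smult)
    also have "\<dots> \<le> B * (norm (Q t) * C)"
      using cb[OF k, of "t - x"] t x order_trans[OF norm_matrix_vector_mult_le mult_left_mono[OF ub[OF k, of t]], of "Q t"]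
      by (intro mult_mono) (auto intro: order_trans[OF norm_ge_zero])
    finally show "norm (?h k t $ i) \<le> B * C * norm (Q t)" by (simp only: mult_ac)
  qed
  then show ?thesis
  proof (rule holomorphic_transform)
    show "integral {x..} (\<lambda>t. ?h k t $ i) = integral {x..} (?h k) $ i" if "k \<in> ball k0 r" for k
      using integral_linear[OF int[OF that] bounded_linear_vec_nth[of i]] by (simp add: o_def)
  qed
qed

lemma holomorphic_on_volterra_iterate:
  assumes "x \<ge> 0"
  shows "(\<lambda>k. (volterra k ^^ n) (\<lambda>_. v) x $ i) holomorphic_on {k. Im k > 0}"
  using assms
proof (induction n arbitrary: x i)
  case 0
  then show ?case by simp
next
  case (Suc n)
  show ?case
  proof (rule holomorphic_on_if_locally)
    fix k0 assume "k0 \<in> {k. Im k > 0}"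
    then have k0: "Im k0 > 0" by simp
    define r where "r = Im k0 / 2"
    have r: "r > 0" using k0 by (simp add: r_def)
    have kr: "Im k > 0" "norm k \<ge> r" "k \<noteq> 0" if "k \<in> ball k0 r" for k
      using ball_upper_half_plane[OF k0 that[unfolded r_def]] k0 by (auto simp: r_def)
    have "(\<lambda>k. integral {x..} (\<lambda>t. jost_kernel k (t - x) *s (Q t *v (volterra k ^^ n) (\<lambda>_. v) t)) $ i) holomorphic_on ball k0 r"
    \<comment> \<open>The constants are the kernel and iterate bounds with |k| and the tail replaced
      by \<open>r\<close> and \<open>tail 0\<close>, hence independent of \<open>k\<close> and
      \<open>t\<close>.\<close>
    proof (rule holomorphic_on_kernel_integral[OF Suc.prems, where B = "1 / r" and C = "norm v * ((tail 0 / r) ^ n /\<^sub>R fact n)"])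
      show "(\<lambda>k. jost_kernel k s) holomorphic_on ball k0 r" for s
        unfolding jost_kernel_def by (intro holomorphic_intros) (use kr in auto)
      show "(\<lambda>k. (volterra k ^^ n) (\<lambda>_. v) t $ j) holomorphic_on ball k0 r" if "t \<ge> 0" for t j
        by (rule holomorphic_on_subset[OF Suc.IH[OF that]]) (use kr in auto)
    next
      fix k assume k: "k \<in> ball k0 r"
      show "continuous_on {x..} (\<lambda>t. jost_kernel k (t - x))" by (intro continuous_intros)
      show "norm (jost_kernel k s) \<le> 1 / r" if "s \<ge> 0" for s
      proof -
        have "norm (jost_kernel k s) \<le> 1 / norm k" using norm_jost_kernel_le(1)[of k s] kr(1)[OF k] that by simp
        also have "\<dots> \<le> 1 / r" using kr(2)[OF k] r by (intro divide_left_mono mult_pos_pos) auto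
        finally show ?thesis .
      qed
      note it = volterra_iterate[OF kr(1)[OF k], where u = "\<lambda>_. v" and C = "norm v" and n = n]
      show "continuous_on {0..} ((volterra k ^^ n) (\<lambda>_. v))" by (rule it) auto
      show "norm ((volterra k ^^ n) (\<lambda>_. v) t) \<le> norm v * ((tail 0 / r) ^ n /\<^sub>R fact n)" if t: "t \<ge> 0" for t
      proof -
        have "norm ((volterra k ^^ n) (\<lambda>_. v) t) \<le> norm v / (norm k ^ n * fact n) * tail t ^ n"
          by (rule it(2)) (use t in auto)
        also have "\<dots> \<le> norm v * ((tail 0 / r) ^ n /\<^sub>R fact n)"
          by (rule neumann_majorant[OF r kr(2)[OF k] tail_nonneg[OF t] tail_le[OF t] norm_ge_zero])
        finally show ?thesis .
      qed
    qed
    then show "\<exists>r>0. (\<lambda>k. (volterra k ^^ Suc n) (\<lambda>_. v) x $ i) holomorphic_on ball k0 r"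
      using r by (auto simp: volterra_def)
  qed
qed

end

section \<open>Identification of the series with the given solution, and bounds uniform in the
  spectral parameter\<close>

context jost_vector
begin

lemma m_volterra: "x \<ge> 0 \<Longrightarrow> m x = v + volterra k m x"
  using kernel_integrals(1)[of x] by (simp add: volterra_def Qm_def)

text \<open>As m is given, this is a uniqueness statement: iterating m = v + V m writes the n-th
  partial sum as m - V^n m, and the factorial bound for iterates of the bounded function m sends the
  remainder to zero.\<close>

lemma m_neumann:
  assumes x: "x \<ge> 0"
  shows "(\<lambda>n. (volterra k ^^ n) (\<lambda>_. v) x) sums m x"
proof -
  obtain C where C: "C > 0" "\<And>t. t \<ge> 0 \<Longrightarrow> norm (m t) \<le> C"
    using bounded_m by (auto simp: bounded_pos)
  have em: "continuous_on {0..} ((volterra k ^^ n) m)" "bounded ((volterra k ^^ n) m ` {0..})"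
     "t \<ge> 0 \<Longrightarrow> norm ((volterra k ^^ n) m t) \<le> C / (norm k ^ n * fact n) * tail t ^ n" for n t
    by (rule volterra_iterate[OF k cont_m, of C]; use C in simp)+
  have dm: "continuous_on {0..} ((volterra k ^^ n) (\<lambda>_. v))" "bounded ((volterra k ^^ n) (\<lambda>_. v) ` {0..})" for n
    by (rule volterra_iterate[OF k, of "\<lambda>_. v" "norm v"]; simp)+
  have step: "(volterra k ^^ n) m t = (volterra k ^^ n) (\<lambda>_. v) t + (volterra k ^^ Suc n) m t" if "t \<ge> 0" for n t
    using that
  proof (induction n arbitrary: t)
    case 0
    then show ?case using m_volterra by simp
  next
    case (Suc n)
    have "volterra k ((volterra k ^^ n) m) t = volterra k ((volterra k ^^ n) (\<lambda>_. v)) t + volterra k ((volterra k ^^ Suc n) m) t"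
      by (rule volterra_add[OF k Suc.prems dm em(1,2) Suc.IH])
    then show ?case by simp
  qed
  have part: "(\<Sum>j<n. (volterra k ^^ j) (\<lambda>_. v) x) = m x - (volterra k ^^ n) m x" for n
    by (induction n) (use step[OF x] in \<open>auto simp: algebra_simps\<close>)
  have "(\<lambda>n. (volterra k ^^ n) m x) \<longlonglongrightarrow> 0"
  proof (rule Lim_null_comparison)
    show "\<forall>\<^sub>F n in sequentially. norm ((volterra k ^^ n) m x) \<le> C * ((tail x / norm k) ^ n /\<^sub>R fact n)"
      using em(3)[OF x] by (simp add: field_simps)
    have "(\<lambda>n. (tail x / norm k) ^ n /\<^sub>R fact n) \<longlonglongrightarrow> 0"
      by (rule summable_LIMSEQ_zero[OF summable_exp_generic])
    then show "(\<lambda>n. C * ((tail x / norm k) ^ n /\<^sub>R fact n)) \<longlonglongrightarrow> 0"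
      by (rule tendsto_mult_right_zero)
  qed
  then have "(\<lambda>n. m x - (volterra k ^^ n) m x) \<longlonglongrightarrow> m x - 0" by (intro tendsto_diff tendsto_const)
  then show ?thesis unfolding sums_def part by simp
qed

lemma norm_m_le:
  assumes x: "x \<ge> 0" and r: "0 < r" "r \<le> norm k"
  shows "norm (m x) \<le> norm v * exp (tail 0 / r)"
proof (rule norm_sums_le[OF m_neumann[OF x]])
  show "(\<lambda>n. norm v * ((tail 0 / r) ^ n /\<^sub>R fact n)) sums (norm v * exp (tail 0 / r))"
    by (rule sums_mult[OF exp_converges])
  fix n
  have "norm ((volterra k ^^ n) (\<lambda>_. v) x) \<le> norm v / (norm k ^ n * fact n) * tail x ^ n"
    by (rule volterra_iterate[OF k]) (use x in auto)
  also have "\<dots> \<le> norm v * ((tail 0 / r) ^ n /\<^sub>R fact n)"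
    by (rule neumann_majorant[OF r tail_nonneg[OF x] tail_le[OF x] norm_ge_zero])
  finally show "norm ((volterra k ^^ n) (\<lambda>_. v) x) \<le> norm v * ((tail 0 / r) ^ n /\<^sub>R fact n)" .
qed

text \<open>The rate is uniform in \<open>k\<close> as long as |k| >= r, so one interval far out can
  be chosen on which |f| is bounded below for all such bounded \<open>k\<close> at once.\<close>

lemma norm_m_minus_v_le:
  assumes x: "x \<ge> 0" and r: "0 < r" "r \<le> norm k"
  shows "norm (m x - v) \<le> norm v * exp (tail 0 / r) / r * tail x"
proof -
  have "norm (volterra k m x) \<le> 1 / norm k * (norm v * exp (tail 0 / r)) * (tail x ^ Suc 0 / real (Suc 0))"
    by (rule volterra_bound(2)[OF k x cont_m]) (use norm_m_le[OF _ r] in auto)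
  also have "\<dots> \<le> 1 / r * (norm v * exp (tail 0 / r)) * (tail x ^ Suc 0 / real (Suc 0))"
    using r k_nz tail_nonneg[OF x] by (intro mult_right_mono divide_left_mono mult_pos_pos) auto
  finally show ?thesis using m_volterra[OF x] by (simp add: field_simps)
qed

lemma norm_f'_le:
  assumes x: "x \<ge> 0" and r: "0 < r" "r \<le> norm k"
  shows "norm (exp (- \<i> * k * of_real x) *s f' x) \<le> norm v * (norm k + exp (tail 0 / r) * tail 0)"
proof -
  have "norm (integral {x..} (\<lambda>t. jost_kernel_deriv k (t - x) *s Qm t)) \<le> 1 * (norm v * exp (tail 0 / r)) * (tail x ^ Suc 0 / real (Suc 0))"
    unfolding Qm_def
    by (rule kernel_integral_bound(2)[OF x cont_m])
       (use norm_m_le[OF _ r] k norm_jost_kernel_le(2)[of k] in \<open>auto intro!: continuous_intros\<close>)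
  also have "\<dots> \<le> 1 * (norm v * exp (tail 0 / r)) * tail 0"
    using tail_le[OF x] by (auto intro!: mult_left_mono)
  finally have "norm ((\<i> * k) *s v + integral {x..} (\<lambda>t. jost_kernel_deriv k (t - x) *s Qm t)) \<le> norm k * norm v + norm v * exp (tail 0 / r) * tail 0"
    by (intro norm_triangle_le add_mono) (simp_all add: norm_vector_smult norm_mult)
  then show ?thesis unfolding kernel_integrals(2)[OF x] by (simp add: algebra_simps)
qed

end

text \<open>Nothing relates the families \<open>f k\<close> and \<open>f' k\<close> for different
  \<open>k\<close> except the equation. The Neumann series exhibits m, hence f(0), as a locally
  uniform limit of holomorphic functions; f'(0) is ik v plus an integral of m against
  \<open>jost_kernel_deriv\<close>.\<close>

lemma (in integrable_potential) jost_vector_holomorphic: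
  fixes f f' :: "complex \<Rightarrow> real \<Rightarrow> complex^'n"
  assumes J: "\<And>k. Im k > 0 \<Longrightarrow> jost_vector Q k v (f k) (f' k)"
  shows "(\<lambda>k. f k 0 $ i) holomorphic_on {k. Im k > 0}" and "(\<lambda>k. f' k 0 $ i) holomorphic_on {k. Im k > 0}"
proof -
  define m where "m k = jost_vector.m k (f k)" for k
  have mh: "(\<lambda>k. m k x $ i) holomorphic_on {k. Im k > 0}" if x: "x \<ge> 0" for x i
  proof (rule holomorphic_uniform_sequence)
    show "open {k. Im k > 0}" by (rule open_halfspace_Im_gt)
    show "(\<lambda>k. \<Sum>j<n. (volterra k ^^ j) (\<lambda>_. v) x $ i) holomorphic_on {k. Im k > 0}" for n
      by (intro holomorphic_intros holomorphic_on_volterra_iterate x)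
    fix k0 assume "k0 \<in> {k. Im k > 0}"
    then have k0: "Im k0 > 0" by simp
    define r where "r = Im k0 / 2"
    have r: "r > 0" using k0 by (simp add: r_def)
    \<comment> \<open>Uniform convergence is required on closed discs, hence the smaller
      radius.\<close>
    have sub: "cball k0 (r/2) \<subseteq> ball k0 r" using r by auto
    have kr: "Im k > 0" "norm k \<ge> r" "k \<noteq> 0" if "k \<in> cball k0 (r/2)" for k
      using ball_upper_half_plane[OF k0, of k] subsetD[OF sub that] k0 by (auto simp: r_def)
    have "uniform_limit (cball k0 (r/2)) (\<lambda>n k. \<Sum>j<n. (volterra k ^^ j) (\<lambda>_. v) x $ i)
        (\<lambda>k. suminf (\<lambda>j. (volterra k ^^ j) (\<lambda>_. v) x $ i)) sequentially"
    proof (rule Weierstrass_m_test)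
      show "summable (\<lambda>n. norm v * ((tail 0 / r) ^ n /\<^sub>R fact n))"
        by (intro summable_mult summable_exp_generic)
      fix n k assume k: "k \<in> cball k0 (r/2)"
      have "norm ((volterra k ^^ n) (\<lambda>_. v) x $ i) \<le> norm ((volterra k ^^ n) (\<lambda>_. v) x)" by (rule Finite_Cartesian_Product.norm_nth_le)
      also have "\<dots> \<le> norm v / (norm k ^ n * fact n) * tail x ^ n"
        by (rule volterra_iterate[OF kr(1)[OF k]]) (use x in auto)
      also have "\<dots> \<le> norm v * ((tail 0 / r) ^ n /\<^sub>R fact n)"
        by (rule neumann_majorant[OF r kr(2)[OF k] tail_nonneg[OF x] tail_le[OF x] norm_ge_zero])
      finally show "norm ((volterra k ^^ n) (\<lambda>_. v) x $ i) \<le> norm v * ((tail 0 / r) ^ n /\<^sub>R fact n)" .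
    qed
    moreover have "suminf (\<lambda>j. (volterra k ^^ j) (\<lambda>_. v) x $ i) = m k x $ i" if "k \<in> cball k0 (r/2)" for k
      using bounded_linear.sums[OF bounded_linear_vec_nth jost_vector.m_neumann[OF J[OF kr(1)[OF that]] x]]
      unfolding m_def by (rule sums_unique[symmetric])
    ultimately have "uniform_limit (cball k0 (r/2)) (\<lambda>n k. \<Sum>j<n. (volterra k ^^ j) (\<lambda>_. v) x $ i) (\<lambda>k. m k x $ i) sequentially"
      by (subst (asm) uniform_limit_cong') auto
    then show "\<exists>d>0. cball k0 d \<subseteq> {k. Im k > 0} \<and>
        uniform_limit (cball k0 d) (\<lambda>n k. \<Sum>j<n. (volterra k ^^ j) (\<lambda>_. v) x $ i) (\<lambda>k. m k x $ i) sequentially"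
      using r kr(1) by (intro exI[of _ "r/2"]) auto
  qed
  have m0: "m k 0 = f k 0" if "Im k > 0" for k
    using jost_vector.m_def[OF J[OF that]] by (simp add: m_def)
  show "(\<lambda>k. f k 0 $ i) holomorphic_on {k. Im k > 0}"
    by (rule holomorphic_transform[OF mh[OF order_refl]]) (simp add: m0)
  show "(\<lambda>k. f' k 0 $ i) holomorphic_on {k. Im k > 0}"
  proof (rule holomorphic_on_if_locally)
    fix k0 assume "k0 \<in> {k. Im k > 0}"
    then have k0: "Im k0 > 0" by simp
    define r where "r = Im k0 / 2"
    have r: "r > 0" using k0 by (simp add: r_def)
    have kr: "Im k > 0" "norm k \<ge> r" "k \<noteq> 0" if "k \<in> ball k0 r" for k
      using ball_upper_half_plane[OF k0 that[unfolded r_def]] k0 by (auto simp: r_def)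
    have "(\<lambda>k. integral {0..} (\<lambda>t. jost_kernel_deriv k (t - 0) *s (Q t *v m k t)) $ i) holomorphic_on ball k0 r"
    proof (rule holomorphic_on_kernel_integral[OF order_refl, where B = 1 and C = "norm v * exp (tail 0 / r)"])
      show "(\<lambda>k. jost_kernel_deriv k s) holomorphic_on ball k0 r" for s
        unfolding jost_kernel_deriv_def by (intro holomorphic_intros) auto
      show "(\<lambda>k. m k t $ j) holomorphic_on ball k0 r" if "t \<ge> 0" for t j
        by (rule holomorphic_on_subset[OF mh[OF that]]) (use kr in auto)
    next
      fix k assume k: "k \<in> ball k0 r"
      show "continuous_on {0..} (\<lambda>t. jost_kernel_deriv k (t - 0))" by (intro continuous_intros)
      show "norm (jost_kernel_deriv k s) \<le> 1" if "s \<ge> 0" for s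
        using norm_jost_kernel_le(2)[of k s] kr(1)[OF k] that by simp
      show "continuous_on {0..} (m k)" unfolding m_def by (rule jost_vector.cont_m[OF J[OF kr(1)[OF k]]])
      show "norm (m k t) \<le> norm v * exp (tail 0 / r)" if "t \<ge> 0" for t
        unfolding m_def by (rule jost_vector.norm_m_le[OF J[OF kr(1)[OF k]] that r kr(2)[OF k]])
    qed
    then have "(\<lambda>k. \<i> * k * v $ i + integral {0..} (\<lambda>t. jost_kernel_deriv k (t - 0) *s (Q t *v m k t)) $ i) holomorphic_on ball k0 r"
      by (intro holomorphic_intros)
    then have "(\<lambda>k. f' k 0 $ i) holomorphic_on ball k0 r"
    proof (rule holomorphic_transform)
      fix k assume k: "k \<in> ball k0 r"
      show "\<i> * k * v $ i + integral {0..} (\<lambda>t. jost_kernel_deriv k (t - 0) *s (Q t *v m k t)) $ i = f' k 0 $ i"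
        using jost_vector.kernel_integrals(2)[OF J[OF kr(1)[OF k]] order_refl]
        by (simp add: jost_vector.Qm_def[OF J[OF kr(1)[OF k]]] m_def)
    qed
    then show "\<exists>r>0. (\<lambda>k. f' k 0 $ i) holomorphic_on ball k0 r" using r by blast
  qed
qed

section \<open>Green's identity and the boundary form\<close>

text \<open>The real inner product is the real part of the Hermitian one, so
  \<open>(\<i> *s a) \<bullet> b\<close> is Im <a,b>. In this shape the boundary form is real
  bilinear, as the product rule requires.\<close>

lemma inner_complex_vec: "(x :: complex^'n) \<bullet> y = Re (\<Sum>i\<in>UNIV. cnj (x $ i) * y $ i)"
  by (simp add: inner_vec_def inner_complex_def)

lemma inner_ii_left: "(\<i> *s x) \<bullet> y = - (x \<bullet> (\<i> *s (y :: complex^'n)))"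
  by (simp add: inner_vec_def inner_complex_def sum_negf[symmetric] algebra_simps)

lemma inner_matrix_vector_mult_adj:
  fixes A :: "complex^'n^'n"
  shows "(A *v x) \<bullet> y = x \<bullet> (adj_mat A *v y)"
proof -
  have "(\<Sum>i\<in>UNIV. cnj ((A *v x) $ i) * y $ i) = (\<Sum>i\<in>UNIV. \<Sum>j\<in>UNIV. cnj (x $ j) * (cnj (A $ i $ j) * y $ i))"
    by (simp add: matrix_vector_mult_def sum_distrib_left sum_distrib_right mult_ac)
  also have "\<dots> = (\<Sum>j\<in>UNIV. \<Sum>i\<in>UNIV. cnj (x $ j) * (cnj (A $ i $ j) * y $ i))"
    by (rule sum.swap)
  also have "\<dots> = (\<Sum>j\<in>UNIV. cnj (x $ j) * (adj_mat A *v y) $ j)"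
    by (simp add: matrix_vector_mult_def adj_mat_def sum_distrib_left)
  finally show ?thesis unfolding inner_complex_vec by simp
qed

lemma adj_mat_adj_mat [simp]: "adj_mat (adj_mat A) = A"
  by (simp add: adj_mat_def vec_eq_iff)

lemma adj_mat_mult: "adj_mat (A ** B) = adj_mat B ** adj_mat A"
  by (simp add: adj_mat_def vec_eq_iff matrix_matrix_mult_def mult_ac)

lemma adj_mat_one [simp]: "adj_mat (mat 1) = mat 1"
  by (simp add: adj_mat_def vec_eq_iff mat_def)

lemma norm_unitary_adj:
  assumes "unitary_mat U"
  shows "norm (adj_mat U *v z) = norm z"
proof -
  have "(adj_mat U *v z) \<bullet> (adj_mat U *v z) = z \<bullet> (U *v (adj_mat U *v z))"
    by (simp add: inner_matrix_vector_mult_adj)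
  also have "\<dots> = z \<bullet> z"
    using assms by (simp add: matrix_vector_mul_assoc unitary_mat_def)
  finally show ?thesis by (simp add: norm_eq_sqrt_inner)
qed

lemma smat_mult_vec: "smat c A *v x = c *s (A *v x)"
  by (simp add: smat_def vec_eq_iff matrix_vector_mult_def sum_distrib_left mult_ac)

text \<open>With \<open>z\<^sub>\<plusminus> = b \<plusminus> \<i> a\<close> the boundary vector is \<open>w = (U\<^sup>* z\<^sub>+ + z\<^sub>-)/2\<close>, and
  \<open>|z\<^sub>+|\<^sup>2 - |z\<^sub>-|\<^sup>2\<close> is four times the boundary form.\<close>
lemma boundary_form_bound:
  fixes a b :: "complex^'n"
  assumes U: "unitary_mat U"
  defines "w \<equiv> smat (\<i>/2) (adj_mat U - mat 1) *v a + smat (1/2) (adj_mat U + mat 1) *v b"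
  shows "\<bar>(\<i> *s a) \<bullet> b\<bar> \<le> norm w * (norm a + norm b)"
proof -
  define zp zm where "zp = b + \<i> *s a" and "zm = b - \<i> *s a"
  have w: "2 *\<^sub>R w = adj_mat U *v zp + zm"
    unfolding w_def zp_def zm_def smat_mult_vec matrix_vector_mult_diff_rdistrib matrix_vector_mult_add_rdistrib
      matrix_vector_right_distrib matrix_vector_mult_smult
    by (simp add: vec_eq_iff scaleR_conv_of_real algebra_simps)
  \<comment> \<open>Unitarity enters here: |z+| = |U^* z+| = |2w - z-|, so |z+| and |z-| differ by
    at most 2|w|.\<close>
  have "norm zp = norm (2 *\<^sub>R w - zm)"
    unfolding w using norm_unitary_adj[OF U, of zp] by simp
  then have d: "\<bar>norm zp - norm zm\<bar> \<le> 2 * norm w"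
    using norm_triangle_ineq4[of "2 *\<^sub>R w" zm] norm_triangle_ineq2[of zm "2 *\<^sub>R w"]
    by (simp add: norm_minus_commute abs_le_iff)
  have "norm (\<i> *s a) = norm a" by (simp add: norm_vector_smult)
  then have s: "norm zp + norm zm \<le> 2 * (norm a + norm b)"
    using norm_triangle_ineq[of b "\<i> *s a"] norm_triangle_ineq4[of b "\<i> *s a"] by (simp add: zp_def zm_def)
  have "4 * ((\<i> *s a) \<bullet> b) = (norm zp)\<^sup>2 - (norm zm)\<^sup>2"
    unfolding zp_def zm_def power2_norm_eq_inner by (simp add: inner_add_left inner_add_right inner_diff_left inner_diff_right inner_commute)
  also have "\<dots> = (norm zp - norm zm) * (norm zp + norm zm)" by (simp add: power2_eq_square algebra_simps)
  finally have "4 * \<bar>(\<i> *s a) \<bullet> b\<bar> = \<bar>norm zp - norm zm\<bar> * (norm zp + norm zm)"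
    by (metis abs_mult abs_numeral abs_of_nonneg add_nonneg_nonneg norm_ge_zero)
  also have "\<dots> \<le> (2 * norm w) * (2 * (norm a + norm b))"
    by (rule mult_mono[OF d s]) auto
  finally show ?thesis by (simp add: algebra_simps)
qed

lemma bounded_bilinear_boundary_form: "bounded_bilinear (\<lambda>a b. (\<i> *s a) \<bullet> (b :: complex^'n))"
  by (rule bounded_bilinear.comp1[OF bounded_bilinear_inner
        bounded_bilinear.bounded_linear_right[OF bounded_bilinear_vector_smult]])

lemma boundary_form_self: "(\<i> *s a) \<bullet> (a :: complex^'n) = 0"
  using inner_ii_left[of a a] by (simp add: inner_commute)

lemma boundary_form_smult: "(\<i> *s a) \<bullet> (c *s a) = Im c * (norm (a :: complex^'n))\<^sup>2"
  unfolding power2_norm_eq_inner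
  by (simp add: inner_vec_def inner_complex_def sum_distrib_left algebra_simps)

text \<open>Moving \<open>A\<close> and then \<open>\<i>\<close> across the product returns the
  negative of the same real number; equivalently, <a, A a> is real.\<close>

lemma boundary_form_selfadjoint:
  assumes "adj_mat A = A"
  shows "(\<i> *s a) \<bullet> (A *v a) = 0"
proof -
  have "(\<i> *s a) \<bullet> (A *v a) = (A *v (\<i> *s a)) \<bullet> a"
    using inner_matrix_vector_mult_adj[of A "\<i> *s a" a] assms by simp
  also have "\<dots> = (\<i> *s (A *v a)) \<bullet> a" by (simp add: matrix_vector_mult_smult)
  also have "\<dots> = - ((A *v a) \<bullet> (\<i> *s a))" by (rule inner_ii_left)
  finally show ?thesis by (simp add: inner_commute)
qed

context jost_vector
begin

lemma norm_exp_cancel: "norm (u :: complex^'n) = exp (- Im k * x) * norm (exp (- \<i> * k * of_real x) *s u)"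
  by (simp add: norm_vector_smult norm_exp_eq_Re flip: exp_add mult.assoc)

text \<open>The derivative of Im <f,f'> is Im <f',f'> + Im <f, Q f - k^2 f>. The first term
  vanishes, the \<open>Q\<close> part vanishes by selfadjointness, and -Im (k^2) |f|^2 remains; its
  sign explains the order of the boundary terms.\<close>

lemma green_identity:
  assumes sa: "\<forall>t\<ge>0. adj_mat (Q t) = Q t" and x: "x \<ge> 0"
  shows "((\<lambda>t. Im (k\<^sup>2) * (norm (f t))\<^sup>2) has_integral ((\<i> *s f 0) \<bullet> f' 0 - (\<i> *s f x) \<bullet> f' x)) {0..x}"
proof -
  have cf: "continuous_on {0..x} f" by (rule continuous_on_subset[OF cont_f]) auto
  have af: "f' absolutely_integrable_on {0..x}" by (rule absolutely_integrable_continuous_real[OF cont_f'])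
  have ar: "(\<lambda>t. Q t *v f t - k\<^sup>2 *s f t) absolutely_integrable_on {0..x}"
    by (intro set_integral_diff(1) abs_Qf absolutely_integrable_continuous_real
        bounded_bilinear.continuous_on[OF bounded_bilinear_vector_smult] continuous_on_const cf)
  have "((\<lambda>t. (\<i> *s f' t) \<bullet> f' t + (\<i> *s f t) \<bullet> (Q t *v f t - k\<^sup>2 *s f t)) has_integral
      ((\<i> *s f x) \<bullet> f' x - (\<i> *s f 0) \<bullet> f' 0)) {0..x}"
    by (rule product_rule_indefinite_integrals[OF bounded_bilinear_boundary_form x af ar])
       (use f_integral f' in auto)
  then have "((\<lambda>t. - ((\<i> *s f' t) \<bullet> f' t + (\<i> *s f t) \<bullet> (Q t *v f t - k\<^sup>2 *s f t))) has_integral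
      - ((\<i> *s f x) \<bullet> f' x - (\<i> *s f 0) \<bullet> f' 0)) {0..x}"
    by (rule has_integral_neg)
  then show ?thesis
  proof (rule has_integral_eq_rhs[OF has_integral_eq, rotated])
    fix t assume "t \<in> {0..x}"
    then show "- ((\<i> *s f' t) \<bullet> f' t + (\<i> *s f t) \<bullet> (Q t *v f t - k\<^sup>2 *s f t)) = Im (k\<^sup>2) * (norm (f t))\<^sup>2"
      using sa by (simp only: inner_diff_right boundary_form_self boundary_form_smult boundary_form_selfadjoint atLeastAtMost_iff)
  qed simp
qed

lemma boundary_form_tendsto_0: "((\<lambda>x. (\<i> *s f x) \<bullet> f' x) \<longlongrightarrow> 0) at_top"
proof (rule Lim_null_comparison)
  \<comment> \<open>\<open>k\<close> is fixed here, so the bounds for m and f' may be taken with r =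
    |k|; \<open>D\<close> is their product.\<close>
  define D where "D = norm v * exp (tail 0 / norm k) * (norm v * (norm k + exp (tail 0 / norm k) * tail 0))"
  have kn: "0 < norm k" using k_nz by simp
  show "((\<lambda>x. exp (- Im k * x) * exp (- Im k * x) * D) \<longlongrightarrow> 0) at_top"
    using k by real_asymp
  show "\<forall>\<^sub>F x in at_top. norm ((\<i> *s f x) \<bullet> f' x) \<le> exp (- Im k * x) * exp (- Im k * x) * D"
    using eventually_ge_at_top[of 0]
  proof eventually_elim
    case (elim x)
    have "norm ((\<i> *s f x) \<bullet> f' x) \<le> norm (f x) * norm (f' x)"
      using Cauchy_Schwarz_ineq2[of "\<i> *s f x" "f' x"] by (simp add: norm_vector_smult)
    also have "\<dots> = exp (- Im k * x) * exp (- Im k * x) * (norm (m x) * norm (exp (- \<i> * k * of_real x) *s f' x))"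
      using norm_exp_cancel[of "f x" x] norm_exp_cancel[of "f' x" x] by (simp add: m_def)
    also have "\<dots> \<le> exp (- Im k * x) * exp (- Im k * x) * D"
      unfolding D_def
      by (intro mult_left_mono[OF mult_mono[OF norm_m_le[OF elim kn order_refl] norm_f'_le[OF elim kn order_refl]]]) auto
    finally show ?case .
  qed
qed

text \<open>The integrand of Green's identity has constant sign, so all of [0,x] except [X,X+1] may
  be discarded, which leaves at least c^2. The boundary term at x disappears as x tends to
  infinity.\<close>

lemma boundary_form_lower_bound:
  assumes sa: "\<forall>t\<ge>0. adj_mat (Q t) = Q t" and X: "X \<ge> 0" and c: "c \<ge> 0"
    and lb: "\<And>t. t \<in> {X..X+1} \<Longrightarrow> c \<le> norm (f t)"
  shows "\<bar>Im (k\<^sup>2)\<bar> * c\<^sup>2 \<le> \<bar>(\<i> *s f 0) \<bullet> f' 0\<bar>"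
proof -
  have ineq: "\<bar>Im (k\<^sup>2)\<bar> * c\<^sup>2 \<le> \<bar>(\<i> *s f 0) \<bullet> f' 0 - (\<i> *s f x) \<bullet> f' x\<bar>" if x: "x \<ge> X + 1" for x
  proof -
    have cf: "continuous_on S f" if "S \<subseteq> {0..}" for S by (rule continuous_on_subset[OF cont_f that])
    have i: "(\<lambda>t. (norm (f t))\<^sup>2) integrable_on {p..q}" if "p \<ge> 0" for p q
      by (intro integrable_continuous_interval continuous_intros cf) (use that in auto)
    have "c\<^sup>2 = integral {X..X+1} (\<lambda>t. c\<^sup>2)" by simp
    also have "\<dots> \<le> integral {X..X+1} (\<lambda>t. (norm (f t))\<^sup>2)"
      by (rule integral_le[OF _ i[OF X]]) (use lb c in \<open>auto intro!: power_mono\<close>)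
    also have "\<dots> \<le> integral {0..x} (\<lambda>t. (norm (f t))\<^sup>2)"
      by (rule integral_subset_le[OF _ i[OF X] i]) (use X x in auto)
    finally have "\<bar>Im (k\<^sup>2)\<bar> * c\<^sup>2 \<le> \<bar>Im (k\<^sup>2)\<bar> * \<bar>integral {0..x} (\<lambda>t. (norm (f t))\<^sup>2)\<bar>"
      by (intro mult_left_mono) auto
    also have "\<dots> = \<bar>integral {0..x} (\<lambda>t. Im (k\<^sup>2) * (norm (f t))\<^sup>2)\<bar>"
      by (simp only: integral_mult_right abs_mult)
    also have "\<dots> = \<bar>(\<i> *s f 0) \<bullet> f' 0 - (\<i> *s f x) \<bullet> f' x\<bar>"
      using integral_unique[OF green_identity[OF sa, of x]] X x by simp
    finally show ?thesis .
  qed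
  have "((\<lambda>x. \<bar>(\<i> *s f 0) \<bullet> f' 0 - (\<i> *s f x) \<bullet> f' x\<bar>) \<longlongrightarrow> \<bar>(\<i> *s f 0) \<bullet> f' 0 - 0\<bar>) at_top"
    by (intro tendsto_intros boundary_form_tendsto_0)
  then have "\<bar>Im (k\<^sup>2)\<bar> * c\<^sup>2 \<le> \<bar>(\<i> *s f 0) \<bullet> f' 0 - 0\<bar>"
    by (rule tendsto_lowerbound) (use eventually_mono[OF eventually_ge_at_top[of "X+1"] ineq] in auto)
  then show ?thesis by simp
qed

end

text \<open>The two sides of the boundary form estimate are quadratic in \<open>v\<close>, and
  |f(0)| + |f'(0)| is at most C |v|; dividing by one factor |v| leaves a bound for the boundary
  vector alone, with one constant for all \<open>k\<close> in the annulus.\<close>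

lemma (in integrable_potential) boundary_vector_lower_bound:
  assumes sa: "\<forall>t\<ge>0. adj_mat (Q t) = Q t" and U: "unitary_mat U" and r: "0 < r"
  shows "\<exists>c>0. \<forall>k v f f'. jost_vector Q k v f f' \<and> r \<le> norm k \<and> norm k \<le> R \<longrightarrow>
     c * \<bar>Im (k\<^sup>2)\<bar> * norm v \<le> norm (smat (\<i>/2) (adj_mat U - mat 1) *v f 0 + smat (1/2) (adj_mat U + mat 1) *v f' 0)"
proof -
  define E where "E = exp (tail 0 / r)"
  have E: "E > 0" by (simp add: E_def)
  have "((\<lambda>x. E / r * tail x) \<longlongrightarrow> E / r * 0) at_top" by (intro tendsto_intros tail_tendsto_0)
  then have "\<forall>\<^sub>F x in at_top. E / r * tail x < 1/2" by (rule order_tendstoD) simp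
  \<comment> \<open>Beyond \<open>X0\<close> the distance from m to v is at most |v|/2, uniformly in
    \<open>k\<close>.\<close>
  then obtain X0 where X0: "\<And>x. x \<ge> X0 \<Longrightarrow> E / r * tail x < 1/2" by (auto simp: eventually_at_top_linorder)
  define X where "X = max 0 X0"
  \<comment> \<open>1/2 is what remains of |v| in |m|, and the exponential is the worst decay of
    exp(ikx) on [X,X+1] when |k| <= R.\<close>
  define a where "a = exp (- R * (X + 1)) / 2"
  define C where "C = E + \<bar>R\<bar> + E * tail 0 + 1"
  have X: "X \<ge> 0" and a: "a > 0" by (auto simp: X_def a_def)
  have C: "C > 0" using E tail_nonneg[of 0] by (auto simp: C_def intro!: add_nonneg_pos add_nonneg_nonneg)
  show ?thesis
  proof (intro exI[of _ "a\<^sup>2 / C"] conjI allI impI)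
    show "0 < a\<^sup>2 / C" using a C by simp
    fix k v f f'
    assume "jost_vector Q k v f f' \<and> r \<le> norm k \<and> norm k \<le> R"
    then interpret jost_vector Q k v f f' by simp
    from \<open>jost_vector Q k v f f' \<and> r \<le> norm k \<and> norm k \<le> R\<close> have kr: "r \<le> norm k" "norm k \<le> R" by auto
    define w where "w = smat (\<i>/2) (adj_mat U - mat 1) *v f 0 + smat (1/2) (adj_mat U + mat 1) *v f' 0"
    have lb: "a * norm v \<le> norm (f t)" if t: "t \<in> {X..X+1}" for t
    proof -
      have t0: "t \<ge> 0" using t X by simp
      have "norm (m t - v) \<le> norm v * (E / r * tail t)"
        using norm_m_minus_v_le[OF t0 r kr(1)] by (simp add: E_def)
      also have "\<dots> \<le> norm v * (1/2)"
        using X0[of t] t by (intro mult_left_mono) (auto simp: X_def)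
      finally have m: "norm v / 2 \<le> norm (m t)" using norm_triangle_ineq2[of v "v - m t"] by (simp add: norm_minus_commute)
      have "Im k * t \<le> R * (X + 1)"
        using k kr(2) abs_Im_le_cmod[of k] t t0 by (intro mult_mono) auto
      then have "exp (- R * (X + 1)) * (norm v / 2) \<le> exp (- Im k * t) * norm (m t)"
        using m by (intro mult_mono) auto
      then show ?thesis using norm_exp_cancel[of "f t" t] by (simp add: a_def m_def)
    qed
    have f0: "norm (f 0) \<le> norm v * E" using norm_m_le[OF order_refl r kr(1)] by (simp add: m_def E_def)
    have "norm (f' 0) \<le> norm v * (norm k + E * tail 0)" using norm_f'_le[OF order_refl r kr(1)] by (simp add: E_def)
    also have "\<dots> \<le> norm v * (\<bar>R\<bar> + E * tail 0)" using kr(2) by (intro mult_left_mono) auto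
    finally have "norm (f 0) + norm (f' 0) \<le> norm v * E + norm v * (\<bar>R\<bar> + E * tail 0)" using f0 by linarith
    also have "\<dots> \<le> norm v * C" by (simp add: C_def algebra_simps)
    finally have fC: "norm (f 0) + norm (f' 0) \<le> norm v * C" .
    have "\<bar>Im (k\<^sup>2)\<bar> * (a * norm v)\<^sup>2 \<le> \<bar>(\<i> *s f 0) \<bullet> f' 0\<bar>"
      by (rule boundary_form_lower_bound[OF sa X _ lb]) (use a in auto)
    also have "\<dots> \<le> norm w * (norm (f 0) + norm (f' 0))" unfolding w_def by (rule boundary_form_bound[OF U])
    also have "\<dots> \<le> norm w * (norm v * C)" by (rule mult_left_mono[OF fC]) simp
    finally have "norm v * (\<bar>Im (k\<^sup>2)\<bar> * a\<^sup>2 * norm v) \<le> norm v * (norm w * C)"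
      by (simp add: power2_eq_square mult_ac)
    then have "\<bar>Im (k\<^sup>2)\<bar> * a\<^sup>2 * norm v \<le> norm w * C" if "v \<noteq> 0"
      using that by (simp add: mult_le_cancel_left)
    then have "\<bar>Im (k\<^sup>2)\<bar> * a\<^sup>2 * norm v \<le> norm w * C" using C by (cases "v = 0") auto
    then have "a\<^sup>2 / C * \<bar>Im (k\<^sup>2)\<bar> * norm v \<le> norm w" using C by (simp add: field_simps)
    then show "a\<^sup>2 / C * \<bar>Im (k\<^sup>2)\<bar> * norm v \<le> norm (smat (\<i>/2) (adj_mat U - mat 1) *v f 0 + smat (1/2) (adj_mat U + mat 1) *v f' 0)"
      unfolding w_def .
  qed
qed

section \<open>Inverses of holomorphic matrix functions\<close>

lemma holomorphic_on_det:
  fixes M :: "complex \<Rightarrow> complex^'n^'n"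
  assumes "\<And>i j. (\<lambda>k. M k $ i $ j) holomorphic_on S"
  shows "(\<lambda>k. det (M k)) holomorphic_on S"
  unfolding det_def by (intro holomorphic_intros assms)

text \<open>A quotient of holomorphic functions has no essential singularity: it either has a finite
  limit at \<open>z\<close> or tends to infinity along every approach, and the bounded sequence
  excludes the latter.\<close>

lemma holomorphic_quotient_extends:
  fixes C D :: "complex \<Rightarrow> complex"
  assumes C: "C holomorphic_on ball z e" and D: "D holomorphic_on ball z e" and e: "e > 0"
    and nz: "\<And>w. w \<in> ball z e - {z} \<Longrightarrow> D w \<noteq> 0"
    and X: "X \<longlonglongrightarrow> z" "\<And>n. X n \<noteq> z" and bd: "\<And>n. norm (C (X n) / D (X n)) \<le> B"
  shows "\<exists>g. g holomorphic_on ball z e \<and> (\<forall>w\<in>ball z e - {z}. g w = C w / D w)"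
proof -
  have z: "z \<in> ball z e" using e by simp
  have "not_essential (\<lambda>w. C w / D w) z"
    by (rule not_essential_divide[OF not_essential_holomorphic[OF C z open_ball] not_essential_holomorphic[OF D z open_ball]];
        rule isolated_singularity_at_holomorphic[OF _ open_ball z], rule holomorphic_on_subset[OF C] holomorphic_on_subset[OF D]) auto
  moreover have "\<not> is_pole (\<lambda>w. C w / D w) z"
  proof
    assume "is_pole (\<lambda>w. C w / D w) z"
    then have "filterlim (\<lambda>w. C w / D w) at_infinity (at z)" by (simp add: is_pole_def)
    moreover have "filterlim X (at z) sequentially" using X by (simp add: filterlim_at)
    ultimately have "filterlim (\<lambda>n. C (X n) / D (X n)) at_infinity sequentially" by (rule filterlim_compose)
    then have "\<forall>\<^sub>F n in sequentially. norm (C (X n) / D (X n)) > B"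
      by (simp add: filterlim_at_infinity_imp_norm_at_top filterlim_at_top_dense
            filterlim_at_infinity_imp_norm_at_top[THEN filterlim_at_top_dense[THEN iffD1], rule_format])
    then obtain n where "norm (C (X n) / D (X n)) > B" by (auto simp: eventually_sequentially)
    with bd[of n] show False by simp
  qed
  ultimately obtain L where L: "((\<lambda>w. C w / D w) \<longlongrightarrow> L) (at z)" by (auto simp: not_essential_def)
  have "(\<lambda>w. C w / D w) holomorphic_on ball z e - {z}"
    by (intro holomorphic_on_divide holomorphic_on_subset[OF C] holomorphic_on_subset[OF D] nz) auto
  from removable_singularity[OF this open_ball L] show ?thesis
    by (intro exI[of _ "\<lambda>y. if y = z then L else C y / D y"]) auto
qed

lemma matrix_vector_mult_axis:
  fixes A :: "'a::semiring_1^'n^'m"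
  shows "(A *v axis j 1) $ i = A $ i $ j"
  by (simp add: matrix_vector_mult_def axis_def if_distrib[of "\<lambda>x. _ * x"] cong: if_cong)

lemma matrix_inv_entry_cramer:
  fixes A :: "'a::field^'n^'n"
  assumes "invertible A"
  shows "matrix_inv A $ i $ j = det (\<chi> a b. if b = i then axis j 1 $ a else A $ a $ b) / det A"
proof -
  have "A ** matrix_inv A = mat 1"
    using assms unfolding invertible_def matrix_inv_def by (metis (mono_tags, lifting) someI_ex)
  then have "A *v (matrix_inv A *v axis j 1) = axis j 1" by (simp add: matrix_vector_mul_assoc)
  then have "matrix_inv A *v axis j 1 = (\<chi> i. det (\<chi> a b. if b = i then axis j 1 $ a else A $ a $ b) / det A)"
    using assms by (simp add: cramer invertible_det_nz)
  moreover have "matrix_inv A $ i $ j = (matrix_inv A *v axis j 1) $ i"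
    by (rule matrix_vector_mult_axis[symmetric])
  ultimately show ?thesis by simp
qed

text \<open>The adjoint is injective, so it has a left inverse whose adjoint is a right inverse of
  \<open>A\<close>. Row i of the inverse is the conjugate of the solution of A^* x = e_i, whose norm
  is at most 1/c.\<close>

lemma invertible_if_adj_bounded_below:
  fixes A :: "complex^'n^'n"
  assumes c: "c > 0" and b: "\<And>v. c * norm v \<le> norm (adj_mat A *v v)"
  shows "invertible A" and "norm (matrix_inv A $ i $ j) \<le> 1 / c"
proof -
  have "v = 0" if "adj_mat A *v v = 0" for v
    using b[of v] that c by (simp add: mult_le_0_iff)
  then obtain B where "B ** adj_mat A = mat 1" using matrix_left_invertible_ker[of "adj_mat A"] by blast
  then have "A ** adj_mat B = mat 1"
    by (metis adj_mat_mult adj_mat_adj_mat adj_mat_one)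
  then show inv: "invertible A" unfolding invertible_right_inverse by blast
  have N: "matrix_inv A ** A = mat 1"
    using inv unfolding invertible_def matrix_inv_def by (metis (mono_tags, lifting) someI_ex)
  then have "adj_mat A ** adj_mat (matrix_inv A) = mat 1"
    by (metis adj_mat_mult adj_mat_one)
  then have "adj_mat A *v (adj_mat (matrix_inv A) *v axis i 1) = axis i 1"
    by (simp add: matrix_vector_mul_assoc)
  then have "c * norm (adj_mat (matrix_inv A) *v axis i 1) \<le> 1"
    using b[of "adj_mat (matrix_inv A) *v axis i 1"] by simp
  moreover have "norm (matrix_inv A $ i $ j) \<le> norm (adj_mat (matrix_inv A) *v axis i 1)"
    using Finite_Cartesian_Product.norm_nth_le[of "adj_mat (matrix_inv A) *v axis i 1" j]
    unfolding matrix_vector_mult_axis by (simp add: adj_mat_def)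
  ultimately have "c * norm (matrix_inv A $ i $ j) \<le> 1"
    using mult_left_mono[of _ _ c] c by (meson less_imp_le order_trans)
  then show "norm (matrix_inv A $ i $ j) \<le> 1 / c" using c by (simp add: field_simps)
qed

text \<open>Covers regular points as well: where \<open>M k0\<close> is invertible, \<open>N\<close>
  comes out zero.\<close>

lemma matrix_inverse_simple_pole:
  fixes M :: "complex \<Rightarrow> complex^'n^'n"
  assumes h: "\<And>i j. (\<lambda>k. M k $ i $ j) holomorphic_on ball k0 e0" and e0: "e0 > 0" and c: "c > 0"
    and b: "\<And>k v. k \<in> ball k0 e0 \<Longrightarrow> c * \<bar>Re k\<bar> * norm v \<le> norm (adj_mat (M k) *v v)"
  shows "\<exists>e>0. \<exists>N G. e \<le> e0 \<and> (\<forall>i j. (\<lambda>k. G k $ i $ j) holomorphic_on ball k0 e) \<and>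
     (\<forall>k\<in>ball k0 e - {k0}. invertible (M k) \<and> matrix_inv (M k) = smat (1 / (k - k0)) N + G k)"
proof -
  define D where "D k = det (M k)" for k
  have Dh: "D holomorphic_on ball k0 e0" unfolding D_def by (rule holomorphic_on_det[OF h])
  have inv: "invertible (M k)" "norm (matrix_inv (M k) $ i $ j) \<le> 1 / (c * \<bar>Re k\<bar>)"
    if "k \<in> ball k0 e0" "Re k \<noteq> 0" for k i j
    by (rule invertible_if_adj_bounded_below[OF _ b[OF that(1)]]; use that(2) c in simp)+
  \<comment> \<open>The sign points away from the imaginary axis, so a horizontal step of length y
    ends at distance at least y from it.\<close>
  define s :: real where "s = (if Re k0 \<ge> 0 then 1 else -1)"
  have s: "\<bar>Re (k0 + of_real (s * y))\<bar> \<ge> y" "dist k0 (k0 + of_real (s * y)) = y" if "y \<ge> 0" for y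
    using that by (auto simp: s_def dist_norm)
  obtain e where e: "0 < e" "e \<le> e0" "\<And>k. k \<in> ball k0 e - {k0} \<Longrightarrow> D k \<noteq> 0"
  proof (cases "D k0 = 0")
    case True
    \<comment> \<open>Isolating a zero of the determinant at k0 needs a point where the determinant
      does not vanish; any point of the disc off the imaginary axis serves.\<close>
    define \<beta> where "\<beta> = k0 + of_real (s * (e0 / 2))"
    have \<beta>: "\<beta> \<in> ball k0 e0" "Re \<beta> \<noteq> 0"
      using s[of "e0/2"] e0 by (auto simp: \<beta>_def simp del: of_real_mult)
    then have "D \<beta> \<noteq> 0" using inv(1) by (simp add: D_def invertible_det_nz)
    with True obtain r where r: "0 < r" "ball k0 r \<subseteq> ball k0 e0" "\<And>z. z \<in> ball k0 r - {k0} \<Longrightarrow> D z \<noteq> 0"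
      using isolated_zeros[OF Dh open_ball connected_ball, of k0 \<beta>] \<beta>(1) e0 by auto
    show ?thesis
      by (rule that[of "min r e0"]) (use r e0 in auto)
  next
    case False
    have "isCont D k0" using Dh e0 by (metis centre_in_ball continuous_on_eq_continuous_at holomorphic_on_imp_continuous_on open_ball)
    then obtain d where "d > 0" "\<forall>y. dist k0 y < d \<longrightarrow> D y \<noteq> 0" using continuous_at_avoid[of k0 D 0] False by blast
    then show ?thesis by (intro that[of "min d e0"]) (use e0 in auto)
  qed
  have sub: "ball k0 e \<subseteq> ball k0 e0" using e(2) by (rule subset_ball)
  define C where "C i j k = det (\<chi> a b. if b = i then axis j 1 $ a else M k $ a $ b)" for i j k
  have Ch: "C i j holomorphic_on ball k0 e0" for i j
    unfolding C_def
  proof (rule holomorphic_on_det)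
    show "(\<lambda>k. (\<chi> a b. if b = i then axis j 1 $ a else M k $ a $ b) $ a $ b) holomorphic_on ball k0 e0" for a b
      using h by (cases "b = i") auto
  qed
  \<comment> \<open>The offset 2 puts \<open>X 0\<close> at distance e/2; with n + 1 it would lie on
    the boundary of the disc.\<close>
  define X where "X n = k0 + of_real (s * (e / real (n + 2)))" for n
  have X: "X n \<in> ball k0 e" "X n \<noteq> k0" "\<bar>Re (X n)\<bar> \<ge> norm (X n - k0)" "Re (X n) \<noteq> 0" for n
  proof -
    have "e * 1 < e * real (n + 2)" using e(1) by (intro mult_strict_left_mono) auto
    then have y: "0 < e / real (n + 2)" "e / real (n + 2) < e" using e(1) by (simp_all add: divide_less_eq)
    then have d: "dist k0 (X n) = e / real (n + 2)" "\<bar>Re (X n)\<bar> \<ge> e / real (n + 2)"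
      using s[of "e / real (n + 2)"] unfolding X_def by auto
    then show "X n \<in> ball k0 e" "X n \<noteq> k0" "\<bar>Re (X n)\<bar> \<ge> norm (X n - k0)" "Re (X n) \<noteq> 0"
      using y by (auto simp: dist_norm norm_minus_commute)
  qed
  have X0: "(\<lambda>n. e / real (n + 2)) \<longlonglongrightarrow> 0"
    using LIMSEQ_ignore_initial_segment[OF tendsto_divide_0[OF tendsto_const filterlim_real_sequentially[THEN filterlim_at_top_imp_at_infinity]], of e 2] by simp
  have "X \<longlonglongrightarrow> k0 + of_real (s * 0)"
    unfolding X_def by (intro tendsto_add tendsto_const tendsto_of_real tendsto_mult X0)
  then have Xl: "X \<longlonglongrightarrow> k0" by simp
  have ent: "matrix_inv (M k) $ i $ j = C i j k / D k" "invertible (M k)" if "k \<in> ball k0 e - {k0}" for i j k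
  proof -
    show "invertible (M k)" using e(3)[OF that] by (simp add: D_def invertible_det_nz)
    then show "matrix_inv (M k) $ i $ j = C i j k / D k" unfolding C_def D_def by (rule matrix_inv_entry_cramer)
  qed
  have "\<exists>g. g holomorphic_on ball k0 e \<and> (\<forall>k\<in>ball k0 e - {k0}. g k = (k - k0) * C i j k / D k)" for i j
  proof (rule holomorphic_quotient_extends[OF _ _ e(1) e(3) Xl X(2), where B = "1 / c"])
    show "(\<lambda>k. (k - k0) * C i j k) holomorphic_on ball k0 e" "D holomorphic_on ball k0 e"
      using holomorphic_on_subset[OF Ch sub] holomorphic_on_subset[OF Dh sub] by (auto intro!: holomorphic_intros)
    fix n
    have "norm ((X n - k0) * C i j (X n) / D (X n)) = norm (X n - k0) * norm (matrix_inv (M (X n)) $ i $ j)"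
      using ent(1)[of "X n" i j] X(1,2)[of n] by (simp add: norm_mult norm_divide)
    also have "\<dots> \<le> \<bar>Re (X n)\<bar> * (1 / (c * \<bar>Re (X n)\<bar>))"
      using X(1)[of n] sub by (intro mult_mono X(3) inv(2) X(4)) auto
    also have "\<dots> = 1 / c" using X(4)[of n] by simp
    finally show "norm ((X n - k0) * C i j (X n) / D (X n)) \<le> 1 / c" .
  qed auto
  then obtain g where g: "\<And>i j. g i j holomorphic_on ball k0 e"
      "\<And>i j k. k \<in> ball k0 e - {k0} \<Longrightarrow> g i j k = (k - k0) * C i j k / D k" by metis
  \<comment> \<open>\<open>N\<close> collects the values at k0 of the extensions of (k - k0) times
    the inverse; \<open>G\<close> consists of their difference quotients, continued by the
    derivative.\<close>
  define N :: "complex^'n^'n" where "N = (\<chi> i j. g i j k0)"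
  define G :: "complex \<Rightarrow> complex^'n^'n" where
    "G k = (\<chi> i j. if k = k0 then deriv (g i j) k0 else (g i j k - g i j k0) / (k - k0))" for k
  have "(\<lambda>k. G k $ i $ j) holomorphic_on ball k0 e" for i j
    unfolding G_def using pole_lemma_open[OF g(1) open_ball, of k0] by simp
  moreover have "invertible (M k) \<and> matrix_inv (M k) = smat (1 / (k - k0)) N + G k" if k: "k \<in> ball k0 e - {k0}" for k
  proof
    show "invertible (M k)" by (rule ent(2)[OF k])
    have "k \<noteq> k0" using k by simp
    then have "C i j k / D k = 1 / (k - k0) * g i j k0 + (g i j k - g i j k0) / (k - k0)" for i j
      using g(2)[OF k, of i j] by (simp add: add_divide_distrib[symmetric])
    then show "matrix_inv (M k) = smat (1 / (k - k0)) N + G k"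
      using \<open>k \<noteq> k0\<close> ent(1)[OF k] by (simp add: vec_eq_iff smat_def N_def G_def)
  qed
  ultimately show ?thesis using e(1,2) by blast
qed

section \<open>Poles of the inverse Jost matrix\<close>

lemma bounded_linear_mult_vec: "bounded_linear (\<lambda>A :: complex^'n^'m. A *v v)"
  by (rule bounded_bilinear.bounded_linear_left[OF bounded_bilinear_matrix_vector_mult])

lemma jost_solution_imp_jost_vector:
  fixes Q :: "real \<Rightarrow> complex^'n^'n"
  assumes Q: "Q absolutely_integrable_on {0..}" and J: "jost_solution Q F Fx" and k: "Im k > 0"
  shows "jost_vector Q k v (\<lambda>x. F x k *v v) (\<lambda>x. Fx x k *v v)"
proof
  show "Q absolutely_integrable_on {0..}" "Im k > 0" by fact+
next
  fix x :: real assume x: "0 \<le> x"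
  have "((\<lambda>y. F y k) has_vector_derivative Fx x k) (at x within {0..})"
    using J k x unfolding jost_solution_def by auto
  then show "((\<lambda>y. F y k *v v) has_vector_derivative Fx x k *v v) (at x within {0..})"
    by (rule bounded_linear.has_vector_derivative[OF bounded_linear_mult_vec])
  have "((\<lambda>t. Q t ** F t k - smat (k\<^sup>2) (F t k)) has_integral (Fx x k - Fx 0 k)) {0..x}"
    using J k x unfolding jost_solution_def by auto
  from has_integral_linear[OF this bounded_linear_mult_vec[of v]]
  show "((\<lambda>t. Q t *v (F t k *v v) - k\<^sup>2 *s (F t k *v v)) has_integral (Fx x k *v v - Fx 0 k *v v)) {0..x}"
    by (simp add: o_def matrix_vector_mult_diff_rdistrib smat_mult_vec matrix_vector_mul_assoc)
next
  have "((\<lambda>x. smat (exp (- \<i> * k * of_real x)) (F x k)) \<longlongrightarrow> mat 1) at_top"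
    using J k unfolding jost_solution_def by auto
  from bounded_linear.tendsto[OF bounded_linear_mult_vec[of v] this]
  show "((\<lambda>x. exp (- \<i> * k * of_real x) *s (F x k *v v)) \<longlongrightarrow> v) at_top"
    by (simp add: smat_mult_vec)
qed

lemma absolutely_integrable_on_if_weighted:
  fixes Q :: "real \<Rightarrow> 'a::euclidean_space"
  assumes "(\<lambda>t. (1 + t) *\<^sub>R Q t) absolutely_integrable_on {0..}"
  shows "Q absolutely_integrable_on {0..}"
proof -
  have "(\<lambda>t. (1 / (1 + t)) *\<^sub>R ((1 + t) *\<^sub>R Q t)) absolutely_integrable_on {0..}"
  proof (rule absolutely_integrable_bounded_bilinear[OF bounded_bilinear_scaleR _ _ _ assms])
    show "bounded ((\<lambda>t. 1 / (1 + t)) ` {0::real..})"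
      unfolding bounded_iff by (intro exI[of _ 1]) auto
  qed (auto intro!: continuous_intros)
  moreover have "set_integrable lebesgue {0..} (\<lambda>t. (1 / (1 + t)) *\<^sub>R ((1 + t) *\<^sub>R Q t)) = set_integrable lebesgue {0..} Q"
    by (rule set_integrable_cong) auto
  ultimately show ?thesis by simp
qed

text \<open>The reflection in the imaginary axis preserves the half-plane, and the outer conjugation
  undoes the antiholomorphy of the inner one.\<close>

lemma holomorphic_on_reflect:
  assumes "f holomorphic_on {k. Im k > 0}"
  shows "(\<lambda>k. cnj (f (- cnj k))) holomorphic_on {k. Im k > 0}"
proof -
  have "(\<lambda>z. f (- z)) holomorphic_on cnj ` {k. Im k > 0}"
  proof (rule holomorphic_on_compose_gen[of uminus _ f "{k. Im k > 0}", unfolded o_def])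
    show "(\<lambda>z. - z) holomorphic_on cnj ` {k. Im k > 0}" by (intro holomorphic_intros)
  qed (use assms in auto)
  from holomorphic_on_compose_cnj_cnj[OF this open_halfspace_Im_gt] show ?thesis by (simp add: o_def)
qed

lemma adj_mat_smat: "adj_mat (smat c A) = smat (cnj c) (adj_mat A)"
  by (simp add: adj_mat_def smat_def vec_eq_iff)

lemma adj_mat_diff: "adj_mat (A - B) = adj_mat A - adj_mat B"
  by (simp add: adj_mat_def vec_eq_iff)

lemma adj_mat_add: "adj_mat (A + B) = adj_mat A + adj_mat B"
  by (simp add: adj_mat_def vec_eq_iff)

text \<open>Conjugation flips the sign of \<open>\<i>\<close> in \<open>B_mat\<close>, so both terms
  of the bracket become minus the corresponding terms of the boundary vector.\<close>

lemma norm_adj_M_minus: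
  "norm (adj_mat (M_minus F Fx U k) *v v) =
    norm (smat (\<i>/2) (adj_mat U - mat 1) *v (F 0 (- cnj k) *v v)
        + smat (1/2) (adj_mat U + mat 1) *v (Fx 0 (- cnj k) *v v)) / (2 * norm k)"
proof -
  let ?w = "smat (\<i>/2) (adj_mat U - mat 1) *v (F 0 (- cnj k) *v v)
        + smat (1/2) (adj_mat U + mat 1) *v (Fx 0 (- cnj k) *v v)"
  have "adj_mat (M_minus F Fx U k) *v v = (- cnj (- 1 / (2 * \<i> * k))) *s ?w"
    unfolding M_minus_def A_mat_def B_mat_def
    by (simp add: adj_mat_smat adj_mat_diff adj_mat_add adj_mat_mult smat_mult_vec
        matrix_vector_mult_diff_rdistrib matrix_vector_mul_assoc[symmetric] vec_eq_iff algebra_simps)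
  then show ?thesis by (simp only: norm_vector_smult) (simp add: norm_divide norm_mult)
qed

lemma holomorphic_on_M_minus:
  fixes F Fx :: "real \<Rightarrow> complex \<Rightarrow> complex^'n^'n"
  assumes "\<And>i j. (\<lambda>k. F 0 k $ i $ j) holomorphic_on {k. Im k > 0}"
    and "\<And>i j. (\<lambda>k. Fx 0 k $ i $ j) holomorphic_on {k. Im k > 0}"
  shows "(\<lambda>k. M_minus F Fx U k $ i $ j) holomorphic_on {k. Im k > 0}"
  unfolding M_minus_def smat_def matrix_matrix_mult_def
  by (auto simp: adj_mat_def intro!: holomorphic_intros holomorphic_on_reflect[OF assms(1)] holomorphic_on_reflect[OF assms(2)])

text \<open>Formulated at every k0 of the half-plane: k0 is a pole exactly when \<open>N\<close> is
  nonzero, and otherwise \<open>G\<close> continues the inverse across k0. The condition on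
  \<open>e\<close> keeps the disc in the half-plane.\<close>

theorem theorem4:
  fixes Q :: "real \<Rightarrow> complex^'n^'n"
    and U :: "complex^'n^'n"
    and F Fx :: "real \<Rightarrow> complex \<Rightarrow> complex^'n^'n"
  assumes selfadj: "\<forall>t\<ge>0. adj_mat (Q t) = Q t"
    and integrable: "(\<lambda>t. (1 + t) *\<^sub>R Q t) absolutely_integrable_on {0..}"
    and unitary: "unitary_mat U"
    and no_virtual: "\<not> virtual_level_at_zero Q U"
    and jost: "jost_solution Q F Fx"
  shows "\<forall>k0. Im k0 > 0 \<longrightarrow>
           (\<exists>e>0. \<exists>N :: complex^'n^'n. \<exists>G :: complex \<Rightarrow> complex^'n^'n.
              e \<le> Im k0 \<and>
              (\<forall>i j. (\<lambda>k. G k $ i $ j) holomorphic_on ball k0 e) \<and>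
              (\<forall>k\<in>ball k0 e - {k0}.
                 invertible (M_minus F Fx U k) \<and>
                 matrix_inv (M_minus F Fx U k) = smat (1 / (k - k0)) N + G k))"
proof (intro allI impI)
  fix k0 assume k0: "Im k0 > 0"
  have Q: "Q absolutely_integrable_on {0..}" by (rule absolutely_integrable_on_if_weighted[OF integrable])
  interpret integrable_potential Q by (standard) (rule Q)
  note J = jost_solution_imp_jost_vector[OF Q jost]
  have FH: "(\<lambda>k. F 0 k $ i $ j) holomorphic_on {k. Im k > 0}"
    "(\<lambda>k. Fx 0 k $ i $ j) holomorphic_on {k. Im k > 0}" for i j
    using jost_vector_holomorphic[OF J, of "axis j 1" i] by (simp_all only: matrix_vector_mult_axis)
  define r where "r = Im k0 / 2"
  define R where "R = norm k0 + r"
  have r: "r > 0" using k0 by (simp add: r_def)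
  have R: "R > 0" using r by (simp add: R_def add_nonneg_pos)
  have kr: "Im k > r" "norm k \<ge> r" if "k \<in> ball k0 r" for k
    using ball_upper_half_plane[OF k0 that[unfolded r_def]] by (auto simp: r_def)
  obtain c where c: "c > 0" "\<And>k v f f'. \<lbrakk>jost_vector Q k v f f'; r \<le> norm k; norm k \<le> R\<rbrakk> \<Longrightarrow>
     c * \<bar>Im (k\<^sup>2)\<bar> * norm v \<le> norm (smat (\<i>/2) (adj_mat U - mat 1) *v f 0 + smat (1/2) (adj_mat U + mat 1) *v f' 0)"
    using boundary_vector_lower_bound[OF selfadj unitary r, of R] by blast
  have "\<exists>e>0. \<exists>N G. e \<le> r \<and> (\<forall>i j. (\<lambda>k. G k $ i $ j) holomorphic_on ball k0 e) \<and>
     (\<forall>k\<in>ball k0 e - {k0}. invertible (M_minus F Fx U k) \<and> matrix_inv (M_minus F Fx U k) = smat (1 / (k - k0)) N + G k)"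
  proof (rule matrix_inverse_simple_pole)
    show "(\<lambda>k. M_minus F Fx U k $ i $ j) holomorphic_on ball k0 r" for i j
      by (rule holomorphic_on_subset[OF holomorphic_on_M_minus[of F Fx, OF FH]]) (use kr(1) r in force)
    show "r > 0" by fact
    \<comment> \<open>The constant combines |Im \<zeta>^2| >= 2 r |Re k| with the prefactor 1/(2|k|)
      >= 1/(2R); the factors 2 cancel.\<close>
    show "0 < c * r / R" using c(1) r R by simp
    fix k v assume k: "k \<in> ball k0 r"
    have kR: "norm k \<le> R"
      using norm_triangle_ineq2[of k k0] k by (simp add: R_def dist_norm norm_minus_commute)
    have "norm k > 0" using kr(2)[OF k] r by linarith
    let ?w = "smat (\<i>/2) (adj_mat U - mat 1) *v (F 0 (- cnj k) *v v)
        + smat (1/2) (adj_mat U + mat 1) *v (Fx 0 (- cnj k) *v v)"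
    \<comment> \<open>Reflection preserves modulus and imaginary part, so the constants chosen for
      \<open>k\<close> apply to \<zeta>.\<close>
    have "Im (- cnj k) > 0" using kr(1)[OF k] r by simp
    from c(2)[OF J[OF this]] have w: "c * \<bar>Im ((- cnj k)\<^sup>2)\<bar> * norm v \<le> norm ?w"
      using kr(2)[OF k] kR by simp
    have "\<bar>Im ((- cnj k)\<^sup>2)\<bar> = 2 * (Im k * \<bar>Re k\<bar>)"
      using kr(1)[OF k] r by (simp add: power2_eq_square abs_mult)
    then have "2 * (r * \<bar>Re k\<bar>) \<le> \<bar>Im ((- cnj k)\<^sup>2)\<bar>"
      using kr(1)[OF k] by (simp add: mult_right_mono)
    then have "c * (2 * (r * \<bar>Re k\<bar>)) * norm v \<le> norm ?w"
      using c(1) by (intro order_trans[OF _ w] mult_right_mono mult_left_mono) auto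
    then have "c * (2 * (r * \<bar>Re k\<bar>)) * norm v / (2 * R) \<le> norm ?w / (2 * norm k)"
      using kR \<open>norm k > 0\<close> by (intro frac_le) auto
    then show "c * r / R * \<bar>Re k\<bar> * norm v \<le> norm (adj_mat (M_minus F Fx U k) *v v)"
      unfolding norm_adj_M_minus by (simp add: mult_ac)
  qed
  then obtain e and N :: "complex^'n^'n" and G :: "complex \<Rightarrow> complex^'n^'n" where "e > 0" "e \<le> r" "\<forall>i j. (\<lambda>k. G k $ i $ j) holomorphic_on ball k0 e"
     "\<forall>k\<in>ball k0 e - {k0}. invertible (M_minus F Fx U k) \<and> matrix_inv (M_minus F Fx U k) = smat (1 / (k - k0)) N + G k"
    by blast
  then show "\<exists>e>0. \<exists>N :: complex^'n^'n. \<exists>G :: complex \<Rightarrow> complex^'n^'n.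
              e \<le> Im k0 \<and>
              (\<forall>i j. (\<lambda>k. G k $ i $ j) holomorphic_on ball k0 e) \<and>
              (\<forall>k\<in>ball k0 e - {k0}.
                 invertible (M_minus F Fx U k) \<and>
                 matrix_inv (M_minus F Fx U k) = smat (1 / (k - k0)) N + G k)"
    using k0 by (intro exI[of _ e] conjI exI[of _ N] exI[of _ G]) (auto simp: r_def)
qed

end
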